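(* Let $A$ be an $n\times n$ irreducible nonnegative real matrix with spectral radius $\rho(A)$, index of imprimitivity $h$, and all row sums nonzero. Let $M>0$, $N\ge0$, $k\ge0$ be integers and $r=\gcd(h,M+N)$, and consider the inequality \[ \min_{\substack{1\le i,j\le n\\ a_{ij}^{(M)}>0}} \left( \frac{r_i(A^{k+M})\, r_j(A^{k+N})}{r_i(A^k)\, r_j(A^k)} \right)^{\frac{1}{M+N}} \le \rho(A) \le \max_{\substack{1\le i,j\le n\\ a_{ij}^{(M)}>0}} \left( \frac{r_i(A^{k+M})\, r_j(A^{k+N})}{r_i(A^k)\, r_j(A^k)} \right)^{\frac{1}{M+N}}. \] If $A^{M+N}$ is reducible (equivalently $r>1$), then equality holds on either side (and hence on both sides) of this inequality if and only if there are constants $c_1,\ldots,c_r$ such that \[ \frac{r_i(A^{k+1})}{r_i(A^k)}=c_{m(i)}\quad\text{for all } i\in\{1,\ldots,n\}. \] Moreover, in that case $\rho(A)^r=\prod_{\ell=1}^r c_\ell$.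
   Context: $a_{ij}^{(m)}$ denotes the $(i,j)$ entry of $A^m$ (with $A^0=I$), and $r_i(B)=\sum_j b_{ij}$ is the $i$-th row sum of a matrix $B$. A nonnegative $n\times n$ matrix $B$ ($n\ge2$) is reducible if there is a permutation matrix $P$ with $PBP^T=\begin{pmatrix}X&Y\\0&Z\end{pmatrix}$, $X,Z$ square; otherwise irreducible. $\rho(A)$ is the maximum modulus of the eigenvalues of $A$; the index of imprimitivity $h$ of an irreducible nonnegative matrix is the number of its eigenvalues of modulus $\rho(A)$. When $r>1$ divides $h$, the index set $\{1,\ldots,n\}$ admits a partition into nonempty classes $V_1,\ldots,V_r$ (the $r$-cyclic partition, determined up to cyclic relabeling) such that $a_{ij}>0$ only if $i\in V_\ell$ and $j\in V_{(\ell \bmod r)+1}$ for some $\ell$; equivalently, after a symmetric permutation $A$ has the block cyclic form with zero diagonal blocks and nonzero blocks only in positions $(\ell,\ell+1)$ and $(r,1)$, and $A^{M+N}$ is then block diagonal with irreducible diagonal blocks indexed by $V_1,\ldots,V_r$. For each $i$, $m(i)$ denotes the $\ell$ with $i\in V_\ell$. *)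

theory Defs
  imports "Jordan_Normal_Form.Spectral_Radius" "HOL-Combinatorics.Permutations"
begin

text \<open>Matrices have row and column indices \<open>0, \<dots>, n - 1\<close>.\<close>

definition nonnegative_mat :: "real mat \<Rightarrow> bool" where
  "nonnegative_mat A \<longleftrightarrow> (\<forall>i < dim_row A. \<forall>j < dim_col A. 0 \<le> A $$ (i, j))"

definition row_sum :: "real mat \<Rightarrow> nat \<Rightarrow> real" where
  "row_sum A i = (\<Sum>j < dim_col A. A $$ (i, j))"

definition permutation_matrix :: "nat \<Rightarrow> real mat \<Rightarrow> bool" where
  "permutation_matrix n P \<longleftrightarrow>
     (\<exists>\<pi>. \<pi> permutes {..<n} \<and> P = mat n n (\<lambda>(i, j). if j = \<pi> i then 1 else 0))"

definition reducible_mat :: "real mat \<Rightarrow> bool" where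
  "reducible_mat B \<longleftrightarrow>
     (\<exists>P p q X Y Z. 0 < p \<and> 0 < q \<and> permutation_matrix (dim_row B) P \<and>
        X \<in> carrier_mat p p \<and> Y \<in> carrier_mat p q \<and> Z \<in> carrier_mat q q \<and>
        P * B * transpose_mat P = four_block_mat X Y (0\<^sub>m q p) Z)"

abbreviation irreducible_mat :: "real mat \<Rightarrow> bool" where
  "irreducible_mat B \<equiv> \<not> reducible_mat B"

text \<open>Eigenvalues of a real matrix are its complex eigenvalues.\<close>

definition real_spectral_radius :: "real mat \<Rightarrow> real" where
  "real_spectral_radius A = spectral_radius (map_mat complex_of_real A)"

text \<open>
  Only used for irreducible nonnegative matrices. Their eigenvalues of maximal modulus are simple,
  so counting distinct eigenvalues agrees with counting multiplicities.
\<close>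

definition imprimitivity_index :: "real mat \<Rightarrow> nat" where
  "imprimitivity_index A =
     card {z \<in> spectrum (map_mat complex_of_real A). cmod z = real_spectral_radius A}"

text \<open>
  A partition into nonempty classes \<open>V\<^sub>0, \<dots>, V\<^sub>r\<^sub>-\<^sub>1\<close> is given by the function \<open>m\<close> that sends an index
  \<open>i\<close> to the number of its class; the classes are numbered from \<open>0\<close>, so that the cyclic
  successor of the class number \<open>l\<close> is \<open>Suc l mod r\<close>.
\<close>

definition cyclic_partition :: "real mat \<Rightarrow> nat \<Rightarrow> (nat \<Rightarrow> nat) \<Rightarrow> bool" where
  "cyclic_partition A r m \<longleftrightarrow>
     m ` {..<dim_row A} = {..<r} \<and>
     (\<forall>i < dim_row A. \<forall>j < dim_col A. 0 < A $$ (i, j) \<longrightarrow> m j = Suc (m i) mod r)"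

definition support_pairs :: "real mat \<Rightarrow> (nat \<times> nat) set" where
  "support_pairs B = {(i, j). i < dim_row B \<and> j < dim_col B \<and> 0 < B $$ (i, j)}"

definition row_sum_ratio :: "real mat \<Rightarrow> nat \<Rightarrow> nat \<Rightarrow> nat \<Rightarrow> nat \<Rightarrow> nat \<Rightarrow> real" where
  "row_sum_ratio A M N k i j =
     ((row_sum (A ^\<^sub>m (k + M)) i * row_sum (A ^\<^sub>m (k + N)) j) /
      (row_sum (A ^\<^sub>m k) i * row_sum (A ^\<^sub>m k) j)) powr (1 / real (M + N))"

definition lower_bound :: "real mat \<Rightarrow> nat \<Rightarrow> nat \<Rightarrow> nat \<Rightarrow> real" where
  "lower_bound A M N k = (MIN (i, j) \<in> support_pairs (A ^\<^sub>m M). row_sum_ratio A M N k i j)"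

definition upper_bound :: "real mat \<Rightarrow> nat \<Rightarrow> nat \<Rightarrow> nat \<Rightarrow> real" where
  "upper_bound A M N k = (MAX (i, j) \<in> support_pairs (A ^\<^sub>m M). row_sum_ratio A M N k i j)"

definition class_ratios :: "real mat \<Rightarrow> nat \<Rightarrow> (nat \<Rightarrow> nat) \<Rightarrow> (nat \<Rightarrow> real) \<Rightarrow> bool" where
  "class_ratios A k m c \<longleftrightarrow>
     (\<forall>i < dim_row A. row_sum (A ^\<^sub>m (k + 1)) i / row_sum (A ^\<^sub>m k) i = c (m i))"

end

theory Submission
  imports Defs "HOL-Number_Theory.Cong"
begin

text \<open>
  Put \<open>x = A\<^sup>k 1\<close>. If all the ratios are at most \<open>\<rho>\<^sup>M\<^sup>+\<^sup>N\<close> before taking roots, then bounding the sum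
  \<open>(A\<^sup>M\<^sup>+\<^sup>N x)\<^sub>i = \<Sum>\<^sub>j a\<^sub>i\<^sub>j\<^sup>(\<^sup>M\<^sup>) (A\<^sup>N x)\<^sub>j\<close> term by term gives \<open>A\<^sup>M\<^sup>+\<^sup>N x \<le> \<rho>\<^sup>M\<^sup>+\<^sup>N x\<close>; pairing with a
  positive left Perron vector turns this into an equality, and similarly with \<open>\<ge>\<close>. Then \<open>x\<close> and
  \<open>A x\<close> are eigenvectors of \<open>A\<^sup>M\<^sup>+\<^sup>N\<close> for the same eigenvalue, hence proportional on each of the \<open>r\<close>
  classes, on which \<open>A\<^sup>M\<^sup>+\<^sup>N\<close> is irreducible. Conversely, if \<open>A x\<close> is \<open>c\<^sub>l x\<close> on the class \<open>l\<close>, then every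
  ratio is a product of the \<open>c\<^sub>l\<close> over \<open>(M + N) / r\<close> turns around the cycle.

  The classes come from walks: the index of imprimitivity equals the gcd \<open>d\<close> of the lengths of the
  closed walks, because equality in the triangle inequality makes the phases of a peripheral
  eigenvector rotate by a constant along each edge, so that the peripheral eigenvalues are exactly
  the \<open>\<rho> \<omega>\<close> with \<open>\<omega>\<^sup>d = 1\<close>.
\<close>

section \<open>Reducibility and closed sets of indices\<close>

lemma permutation_mat_conj:
  fixes B :: "real mat"
  assumes "B \<in> carrier_mat n n" and "\<pi> permutes {..<n}"
    and "P = mat n n (\<lambda>(i, j). if j = \<pi> i then 1 else 0)"
  shows "P * B * transpose_mat P = mat n n (\<lambda>(i, j). B $$ (\<pi> i, \<pi> j))"
proof -
  have \<pi>: "\<pi> i < n" if "i < n" for i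
    using permutes_in_image[OF assms(2), of i] that by simp
  have PB: "(P * B) $$ (i, l) = B $$ (\<pi> i, l)" if "i < n" "l < n" for i l
  proof -
    have "(P * B) $$ (i, l) = (\<Sum>k\<in>{0..<n}. (if k = \<pi> i then 1 else 0) * B $$ (k, l))"
      using assms that by (auto simp: scalar_prod_def intro!: sum.cong)
    also have "\<dots> = (\<Sum>k\<in>{0..<n}. if k = \<pi> i then B $$ (k, l) else 0)"
      by (rule sum.cong) auto
    finally show ?thesis using \<pi>[OF that(1)] by (simp add: sum.delta)
  qed
  show ?thesis
  proof (rule eq_matI)
    fix i j assume "i < dim_row (mat n n (\<lambda>(i, j). B $$ (\<pi> i, \<pi> j)))"
      and "j < dim_col (mat n n (\<lambda>(i, j). B $$ (\<pi> i, \<pi> j)))"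
    then have ij: "i < n" "j < n" by auto
    have "(P * B * transpose_mat P) $$ (i, j) =
        (\<Sum>l\<in>{0..<n}. (P * B) $$ (i, l) * (if l = \<pi> j then 1 else 0))"
      using assms(1,3) ij by (auto simp: scalar_prod_def simp del: index_mult_mat(1) intro!: sum.cong)
         (subst index_mult_mat(1), auto simp: scalar_prod_def simp del: index_mult_mat(1) intro!: sum.cong)
    also have "\<dots> = (\<Sum>l\<in>{0..<n}. if l = \<pi> j then B $$ (\<pi> i, l) else 0)"
      using PB ij by (intro sum.cong) auto
    finally show "(P * B * transpose_mat P) $$ (i, j) = mat n n (\<lambda>(i, j). B $$ (\<pi> i, \<pi> j)) $$ (i, j)"
      using \<pi> ij by (simp add: sum.delta)
  qed (use assms in auto)
qed

text \<open>The lower left zero block says exactly that the indices placed last have no entries into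
  those placed first. Later uses of reducibility go through this graph form.\<close>

lemma reducible_mat_iff_closed_subset:
  fixes B :: "real mat"
  assumes B: "B \<in> carrier_mat n n"
  shows "reducible_mat B \<longleftrightarrow>
    (\<exists>S. S \<subseteq> {..<n} \<and> S \<noteq> {} \<and> S \<noteq> {..<n} \<and> (\<forall>i\<in>S. \<forall>j\<in>{..<n} - S. B $$ (i, j) = 0))"
proof
  assume "reducible_mat B"
  then obtain P p q X Y Z \<pi> where pq: "0 < p" "0 < q" and \<pi>: "\<pi> permutes {..<n}"
    and P: "P = mat n n (\<lambda>(i, j). if j = \<pi> i then 1 else 0)"
    and XYZ: "X \<in> carrier_mat p p" "Y \<in> carrier_mat p q" "Z \<in> carrier_mat q q"
    and eq: "P * B * transpose_mat P = four_block_mat X Y (0\<^sub>m q p) Z"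
    using B unfolding reducible_mat_def permutation_matrix_def by auto
  note eq' = eq[unfolded permutation_mat_conj[OF B \<pi> P]]
  have n: "n = p + q" using arg_cong[OF eq', of dim_row] XYZ by simp
  have inj: "inj_on \<pi> C" for C using permutes_inj[OF \<pi>] by (rule inj_on_subset) simp
  have im: "\<pi> ` {..<n} = {..<n}" using permutes_image[OF \<pi>] .
  \<comment> \<open>The zero block occupies the last \<open>q\<close> rows, so the closed set
    consists of the indices that \<open>\<pi>\<close> puts there.\<close>
  let ?S = "\<pi> ` {p..<n}"
  have compl: "{..<n} - ?S = \<pi> ` {..<p}"
  proof -
    have "\<pi> ` ({..<n} - {p..<n}) = \<pi> ` {..<n} - ?S"
      by (rule inj_on_image_set_diff[OF inj[of UNIV]]) auto
    moreover have "{..<n} - {p..<n} = {..<p}" using n by auto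
    ultimately show ?thesis using im by simp
  qed
  have "?S \<subseteq> {..<n}" using im by auto
  moreover have "?S \<noteq> {}" using n pq by auto
  moreover have "?S \<noteq> {..<n}" using compl pq by auto
  moreover have "B $$ (\<pi> i, \<pi> j) = 0" if "p \<le> i" "i < n" "j < p" for i j
    using arg_cong[OF eq', of "\<lambda>M. M $$ (i, j)"] that n XYZ by simp
  ultimately show "\<exists>S. S \<subseteq> {..<n} \<and> S \<noteq> {} \<and> S \<noteq> {..<n} \<and> (\<forall>i\<in>S. \<forall>j\<in>{..<n} - S. B $$ (i, j) = 0)"
    by (intro exI[of _ ?S]) (auto simp: compl)
next
  assume "\<exists>S. S \<subseteq> {..<n} \<and> S \<noteq> {} \<and> S \<noteq> {..<n} \<and> (\<forall>i\<in>S. \<forall>j\<in>{..<n} - S. B $$ (i, j) = 0)"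
  then obtain S where S: "S \<subseteq> {..<n}" "S \<noteq> {}" "S \<noteq> {..<n}"
    and zero: "\<And>i j. i \<in> S \<Longrightarrow> j \<in> {..<n} - S \<Longrightarrow> B $$ (i, j) = 0" by blast
  have fS: "finite S" using S(1) finite_subset by blast
  define q where "q = card S"
  define p where "p = card ({..<n} - S)"
  have pq: "0 < p" "0 < q" and n: "n = p + q"
    using S fS card_Diff_subset[OF fS S(1)] card_mono[OF _ S(1)]
    by (auto simp: p_def q_def card_gt_0_iff)
  have "card {p..<n} = card S" using n q_def by simp
  then obtain f where f: "bij_betw f {p..<n} S"
    using fS finite_same_card_bij[of "{p..<n}" S] by auto
  have "card {..<p} = card ({..<n} - S)" using p_def by simp
  then obtain g where g: "bij_betw g {..<p} ({..<n} - S)"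
    using finite_same_card_bij[of "{..<p}" "{..<n} - S"] by auto
  \<comment> \<open>The complement of \<open>S\<close> is listed first and \<open>S\<close> last;
    being the identity beyond \<open>n\<close> is what \<open>permutes\<close> demands.\<close>
  define \<pi> where "\<pi> i = (if i < p then g i else if i < n then f i else i)" for i
  have b1: "bij_betw \<pi> {..<p} ({..<n} - S)"
    using g by (rule bij_betw_cong[THEN iffD1, rotated]) (simp add: \<pi>_def)
  have b2: "bij_betw \<pi> {p..<n} S"
    using f by (rule bij_betw_cong[THEN iffD1, rotated]) (simp add: \<pi>_def)
  have "bij_betw \<pi> ({..<p} \<union> {p..<n}) (({..<n} - S) \<union> S)"
    by (rule bij_betw_combine[OF b1 b2]) auto
  moreover have "{..<p} \<union> {p..<n} = {..<n}" "({..<n} - S) \<union> S = {..<n}" using n S by auto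
  ultimately have "bij_betw \<pi> {..<n} {..<n}" by simp
  then have perm: "\<pi> permutes {..<n}" by (rule bij_imp_permutes) (auto simp: \<pi>_def n)
  have low: "\<pi> i \<in> S" if "p \<le> i" "i < n" for i using b2 that by (auto simp: bij_betw_def)
  have up: "\<pi> i \<in> {..<n} - S" if "i < p" for i using b1 that by (auto simp: bij_betw_def)
  define P :: "real mat" where "P = mat n n (\<lambda>(i, j). if j = \<pi> i then 1 else 0)"
  define X where "X = mat p p (\<lambda>(i, j). B $$ (\<pi> i, \<pi> j))"
  define Y where "Y = mat p q (\<lambda>(i, j). B $$ (\<pi> i, \<pi> (j + p)))"
  define Z where "Z = mat q q (\<lambda>(i, j). B $$ (\<pi> (i + p), \<pi> (j + p)))"
  have eq: "P * B * transpose_mat P = four_block_mat X Y (0\<^sub>m q p) Z"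
    unfolding permutation_mat_conj[OF B perm P_def]
    by (rule eq_matI) (auto simp: X_def Y_def Z_def n intro!: zero low up)
  have "permutation_matrix (dim_row B) P"
    unfolding permutation_matrix_def P_def using perm B by auto
  moreover have "X \<in> carrier_mat p p" "Y \<in> carrier_mat p q" "Z \<in> carrier_mat q q"
    by (simp_all add: X_def Y_def Z_def)
  ultimately show "reducible_mat B" unfolding reducible_mat_def using eq pq by metis
qed

section \<open>Entries of matrix powers\<close>

lemma pow_mat_add_index:
  fixes A :: "'a :: semiring_1 mat"
  assumes A: "A \<in> carrier_mat n n" and "i < n" "j < n"
  shows "(A ^\<^sub>m (p + q)) $$ (i, j) = (\<Sum>l<n. (A ^\<^sub>m p) $$ (i, l) * (A ^\<^sub>m q) $$ (l, j))"
proof -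
  have "A ^\<^sub>m (p + q) = A ^\<^sub>m p * A ^\<^sub>m q"
  proof (induction q)
    case 0
    then show ?case using A by (simp add: right_mult_one_mat[OF pow_carrier_mat[OF A]])
  next
    case (Suc q)
    then show ?case using assoc_mult_mat[OF pow_carrier_mat[OF A] pow_carrier_mat[OF A] A] by simp
  qed
  then show ?thesis using assms
    by (auto simp: scalar_prod_def lessThan_atLeast0 intro!: sum.cong)
qed

lemma pow_mat_nonneg:
  fixes A :: "real mat"
  assumes A: "A \<in> carrier_mat n n" and nn: "\<And>i j. i < n \<Longrightarrow> j < n \<Longrightarrow> 0 \<le> A $$ (i, j)"
    and "i < n" "j < n"
  shows "0 \<le> (A ^\<^sub>m p) $$ (i, j)"
  using \<open>j < n\<close>
proof (induction p arbitrary: j)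
  case 0
  then show ?case using A \<open>i < n\<close> by simp
next
  case (Suc p)
  then show ?case
    using pow_mat_add_index[OF A \<open>i < n\<close> Suc.prems, of p 1] A \<open>i < n\<close> nn
    by (auto intro!: sum_nonneg mult_nonneg_nonneg)
qed

section \<open>The spectral radius\<close>

text \<open>Eigenvectors become plain functions on indices, so that later arguments handle finite
  sums rather than vectors of a fixed dimension.\<close>

lemma mem_complex_spectrum_iff:
  assumes A: "A \<in> carrier_mat n n"
  shows "ev \<in> spectrum (map_mat complex_of_real A) \<longleftrightarrow>
    (\<exists>v. (\<exists>i<n. v i \<noteq> 0) \<and> (\<forall>i<n. (\<Sum>j<n. complex_of_real (A $$ (i, j)) * v j) = ev * v i))"
    (is "_ \<longleftrightarrow> ?R")
proof -
  let ?C = "map_mat complex_of_real A"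
  have C: "?C \<in> carrier_mat n n" using A by simp
  have entry: "(?C *\<^sub>v v) $ i = (\<Sum>j<n. complex_of_real (A $$ (i, j)) * v $ j)"
    if "v \<in> carrier_vec n" "i < n" for v i
    using that A by (auto simp: scalar_prod_def lessThan_atLeast0 intro!: sum.cong)
  show ?thesis
  proof
    assume "ev \<in> spectrum ?C"
    then obtain v where v: "v \<in> carrier_vec n" "v \<noteq> 0\<^sub>v n" "?C *\<^sub>v v = ev \<cdot>\<^sub>v v"
      using A by (auto simp: spectrum_def eigenvalue_def eigenvector_def)
    have "\<exists>i<n. v $ i \<noteq> 0"
    proof (rule ccontr)
      assume "\<not> (\<exists>i<n. v $ i \<noteq> 0)"
      then have "v = 0\<^sub>v n" using v(1) by (intro eq_vecI) auto
      with v(2) show False ..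
    qed
    moreover have "(\<Sum>j<n. complex_of_real (A $$ (i, j)) * v $ j) = ev * v $ i" if "i < n" for i
      using entry[OF v(1) that] v that by simp
    ultimately show ?R by (intro exI[of _ "\<lambda>i. v $ i"]) blast
  next
    assume ?R
    then obtain v where v: "\<exists>i<n. v i \<noteq> 0"
      "\<forall>i<n. (\<Sum>j<n. complex_of_real (A $$ (i, j)) * v j) = ev * v i" by blast
    have "?C *\<^sub>v vec n v = ev \<cdot>\<^sub>v vec n v"
    proof (rule eq_vecI)
      fix i assume "i < dim_vec (ev \<cdot>\<^sub>v vec n v)"
      then have i: "i < n" by simp
      show "(?C *\<^sub>v vec n v) $ i = (ev \<cdot>\<^sub>v vec n v) $ i"
        unfolding entry[OF vec_carrier i] using v(2) i by simp
    qed (use A in auto)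
    moreover have "vec n v \<noteq> 0\<^sub>v n"
    proof
      assume *: "vec n v = 0\<^sub>v n"
      have "v i = 0" if "i < n" for i using arg_cong[OF *, of "\<lambda>w. w $ i"] that by simp
      with v(1) show False by blast
    qed
    ultimately have "eigenvector ?C (vec n v) ev" using A by (simp add: eigenvector_def)
    then show "ev \<in> spectrum ?C" by (auto simp: spectrum_def eigenvalue_def)
  qed
qed

lemma cmod_le_real_spectral_radius:
  assumes "A \<in> carrier_mat n n" "0 < n" "ev \<in> spectrum (map_mat complex_of_real A)"
  shows "cmod ev \<le> real_spectral_radius A"
  unfolding real_spectral_radius_def
  by (rule spectral_radius_mem_max(2)[of _ n]) (use assms in auto)

lemma real_spectral_radius_attained:
  assumes "A \<in> carrier_mat n n" "0 < n"
  obtains ev where "ev \<in> spectrum (map_mat complex_of_real A)" "cmod ev = real_spectral_radius A"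
proof -
  have "real_spectral_radius A \<in> norm ` spectrum (map_mat complex_of_real A)"
    unfolding real_spectral_radius_def
    by (rule spectral_radius_mem_max(1)[of _ n]) (use assms in auto)
  then show ?thesis using that by auto
qed

text \<open>
  If \<open>\<mu>\<close> exceeded the spectral radius, then the powers of \<open>A / \<sigma>\<close>, for \<open>\<sigma>\<close> strictly between the two,
  would be bounded but would also expand \<open>z\<close> by powers of \<open>\<mu> / \<sigma> > 1\<close>.
\<close>

lemma positive_supereigenvector_le_spectral_radius:
  fixes A :: "real mat"
  assumes A: "A \<in> carrier_mat n n" and nn: "\<And>i j. i < n \<Longrightarrow> j < n \<Longrightarrow> 0 \<le> A $$ (i, j)"
    and n: "0 < n" and z: "\<And>i. i < n \<Longrightarrow> 0 < z i"
    and super: "\<And>i. i < n \<Longrightarrow> \<mu> * z i \<le> (\<Sum>j<n. A $$ (i, j) * z j)"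
  shows "\<mu> \<le> real_spectral_radius A"
proof (rule ccontr)
  let ?\<rho> = "real_spectral_radius A"
  assume "\<not> \<mu> \<le> ?\<rho>"
  moreover have "0 \<le> ?\<rho>" by (rule real_spectral_radius_attained[OF A n]) (metis norm_ge_zero)
  \<comment> \<open>The midpoint is positive even if the spectral radius is 0, so \<open>A\<close>
    may be divided by it.\<close>
  moreover define \<sigma> where "\<sigma> = (?\<rho> + \<mu>) / 2"
  ultimately have \<sigma>: "0 < \<sigma>" "?\<rho> < \<sigma>" "\<sigma> < \<mu>" by auto
  define B where "B = (1 / \<sigma>) \<cdot>\<^sub>m A"
  have B: "B \<in> carrier_mat n n" and Bij: "\<And>i j. i < n \<Longrightarrow> j < n \<Longrightarrow> B $$ (i, j) = A $$ (i, j) / \<sigma>"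
    using A by (auto simp: B_def)
  have Bnn: "0 \<le> B $$ (i, j)" if "i < n" "j < n" for i j using nn that \<sigma> Bij by simp
  let ?C = "map_mat complex_of_real B"
  have C: "?C \<in> carrier_mat n n" using B by simp
  have small: "cmod ev < 1" if "ev \<in> spectrum ?C" for ev
  proof -
    obtain v where v: "\<exists>i<n. v i \<noteq> 0"
      "\<forall>i<n. (\<Sum>j<n. complex_of_real (B $$ (i, j)) * v j) = ev * v i"
      using \<open>ev \<in> spectrum ?C\<close> mem_complex_spectrum_iff[OF B] by blast
    have "(\<Sum>j<n. complex_of_real (A $$ (i, j)) * v j) = (of_real \<sigma> * ev) * v i" if i: "i < n" for i
    proof -
      have "(\<Sum>j<n. complex_of_real (A $$ (i, j)) * v j) =
          (\<Sum>j<n. of_real \<sigma> * (complex_of_real (B $$ (i, j)) * v j))"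
        using \<sigma> i by (intro sum.cong) (auto simp: Bij)
      also have "\<dots> = of_real \<sigma> * (\<Sum>j<n. complex_of_real (B $$ (i, j)) * v j)"
        by (simp add: sum_distrib_left)
      finally show ?thesis using v(2) i by simp
    qed
    then have "of_real \<sigma> * ev \<in> spectrum (map_mat complex_of_real A)"
      using v(1) mem_complex_spectrum_iff[OF A] by blast
    then have "cmod (of_real \<sigma> * ev) \<le> ?\<rho>" using cmod_le_real_spectral_radius[OF A n] by blast
    then have "\<sigma> * cmod ev \<le> ?\<rho>" using \<sigma>(1) by (simp add: norm_mult)
    then show ?thesis using \<sigma>(2) mult_left_mono[of 1 "cmod ev" \<sigma>] \<sigma>(1) by linarith
  qed
  have "spectral_radius ?C < 1" using spectral_radius_mem_max(1)[OF C n] small by auto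
  then obtain c where c: "\<And>k. norm_bound (?C ^\<^sub>m k) c"
    using spectral_radius_jnf_norm_bound_less_1_upper_triangular[OF C] by blast
  have bound: "(B ^\<^sub>m k) $$ (i, j) \<le> c" if "i < n" "j < n" for k i j
  proof -
    have "?C ^\<^sub>m k = map_mat complex_of_real (B ^\<^sub>m k)" by (rule of_real_hom.mat_hom_pow[OF B, symmetric])
    then have "cmod (complex_of_real ((B ^\<^sub>m k) $$ (i, j))) \<le> c"
      using c[of k] B that by (auto simp: norm_bound_def)
    then show ?thesis by simp
  qed
  have grow: "(\<mu> / \<sigma>) ^ k * z i \<le> (\<Sum>j<n. (B ^\<^sub>m k) $$ (i, j) * z j)" if i: "i < n" for k i
  proof (induction k)
    case 0
    have "(\<Sum>j<n. (B ^\<^sub>m 0) $$ (i, j) * z j) = (\<Sum>j<n. if i = j then z j else 0)"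
      using B i by (intro sum.cong) auto
    then show ?case using i by (simp add: sum.delta')
  next
    case (Suc k)
    have "(\<mu> / \<sigma>) ^ Suc k * z i \<le> (\<mu> / \<sigma>) * (\<Sum>l<n. (B ^\<^sub>m k) $$ (i, l) * z l)"
      using mult_left_mono[OF Suc, of "\<mu> / \<sigma>"] \<sigma> by (simp add: mult.assoc)
    also have "\<dots> = (\<Sum>l<n. (B ^\<^sub>m k) $$ (i, l) * ((\<mu> * z l) / \<sigma>))"
      by (simp add: sum_distrib_left mult_ac)
    also have "\<dots> \<le> (\<Sum>l<n. (B ^\<^sub>m k) $$ (i, l) * ((\<Sum>j<n. A $$ (l, j) * z j) / \<sigma>))"
      using \<sigma> super i
      by (intro sum_mono mult_left_mono divide_right_mono pow_mat_nonneg[OF B Bnn]) auto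
    also have "\<dots> = (\<Sum>l<n. \<Sum>j<n. (B ^\<^sub>m k) $$ (i, l) * B $$ (l, j) * z j)"
      by (intro sum.cong refl)
        (auto simp: sum_distrib_left sum_divide_distrib Bij intro!: sum.cong)
    also have "\<dots> = (\<Sum>j<n. \<Sum>l<n. (B ^\<^sub>m k) $$ (i, l) * B $$ (l, j) * z j)" by (rule sum.swap)
    also have "\<dots> = (\<Sum>j<n. (B ^\<^sub>m Suc k) $$ (i, j) * z j)"
      using i B pow_mat_add_index[OF B, of i _ k 1] by (auto simp: sum_distrib_right intro!: sum.cong)
    finally show ?case .
  qed
  have le: "(\<mu> / \<sigma>) ^ k \<le> c * (\<Sum>j<n. z j) / z 0" for k
  proof -
    have "(\<mu> / \<sigma>) ^ k * z 0 \<le> (\<Sum>j<n. c * z j)"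
      using grow[OF n, of k] by (rule order_trans) (intro sum_mono mult_right_mono bound, use n z in \<open>auto intro: less_imp_le\<close>)
    then show ?thesis using z[OF n] by (simp add: sum_distrib_left pos_le_divide_eq)
  qed
  have "1 < \<mu> / \<sigma>" using \<sigma> by simp
  then obtain k where "c * (\<Sum>j<n. z j) / z 0 < (\<mu> / \<sigma>) ^ k" using real_arch_pow by blast
  with le[of k] show False by simp
qed

section \<open>Perron vectors of irreducible matrices\<close>

text \<open>Since both diagonal blocks must be nonempty, no matrix of size 1 is reducible;
  \<open>two_le\<close> keeps out the zero matrix of that size, which has spectral radius 0.\<close>

locale nonneg_irreducible =
  fixes A :: "real mat" and n :: nat
  assumes carrier: "A \<in> carrier_mat n n" and two_le: "2 \<le> n"
    and nonneg: "nonnegative_mat A" and irreducible: "irreducible_mat A"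
begin

text \<open>\<open>pw p i j\<close> is positive exactly when the digraph of \<open>A\<close> has a
  walk of length \<open>p\<close> from \<open>i\<close> to \<open>j\<close>.\<close>

definition pw :: "nat \<Rightarrow> nat \<Rightarrow> nat \<Rightarrow> real" where
  "pw p i j = (A ^\<^sub>m p) $$ (i, j)"

definition act :: "nat \<Rightarrow> (nat \<Rightarrow> real) \<Rightarrow> nat \<Rightarrow> real" where
  "act p x i = (\<Sum>j<n. pw p i j * x j)"

definition \<rho> :: real where "\<rho> = real_spectral_radius A"

lemma n_pos: "0 < n" using two_le by simp

lemma pw_0: "i < n \<Longrightarrow> j < n \<Longrightarrow> pw 0 i j = (if i = j then 1 else 0)"
  using carrier by (simp add: pw_def)

lemma pw_1: "i < n \<Longrightarrow> j < n \<Longrightarrow> pw (Suc 0) i j = A $$ (i, j)"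
  using carrier by (simp add: pw_def)

lemma entry_nonneg: "i < n \<Longrightarrow> j < n \<Longrightarrow> 0 \<le> A $$ (i, j)"
  using nonneg carrier by (auto simp: nonnegative_mat_def)

lemma pw_nonneg: "i < n \<Longrightarrow> j < n \<Longrightarrow> 0 \<le> pw p i j"
  unfolding pw_def by (rule pow_mat_nonneg[OF carrier entry_nonneg])

lemma pw_add: "i < n \<Longrightarrow> j < n \<Longrightarrow> pw (p + q) i j = (\<Sum>l<n. pw p i l * pw q l j)"
  unfolding pw_def by (rule pow_mat_add_index[OF carrier])

section \<open>Walks in the digraph of \<open>A\<close>\<close>

lemma pw_pos_trans:
  assumes "i < n" "j < n" "l < n" "0 < pw p i j" "0 < pw q j l"
  shows "0 < pw (p + q) i l"
  unfolding pw_add[OF assms(1,3)]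
  by (rule sum_pos2[of _ j]) (use assms pw_nonneg in auto)

lemma pw_pos_split:
  assumes "i < n" "l < n" "0 < pw (p + q) i l"
  obtains j where "j < n" "0 < pw p i j" "0 < pw q j l"
proof -
  have "\<exists>j\<in>{..<n}. 0 < pw p i j * pw q j l"
  proof (rule ccontr)
    assume "\<not> ?thesis"
    then have "(\<Sum>j<n. pw p i j * pw q j l) \<le> 0" by (intro sum_nonpos) (auto simp: not_less)
    then show False using assms pw_add[OF assms(1,2), of p q] by simp
  qed
  then obtain j where j: "j < n" "0 < pw p i j * pw q j l" by blast
  then have "0 < pw p i j" "0 < pw q j l"
    using pw_nonneg[OF assms(1) j(1), of p] pw_nonneg[OF j(1) assms(2), of q]
    by (auto simp: zero_less_mult_iff)
  then show ?thesis using that j by blast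
qed

lemma closed_subset_eq:
  assumes "S \<subseteq> {..<n}" "S \<noteq> {}" "\<And>i j. i \<in> S \<Longrightarrow> j < n \<Longrightarrow> 0 < A $$ (i, j) \<Longrightarrow> j \<in> S"
  shows "S = {..<n}"
proof (rule ccontr)
  assume "S \<noteq> {..<n}"
  moreover have "A $$ (i, j) = 0" if "i \<in> S" "j \<in> {..<n} - S" for i j
    using assms that entry_nonneg[of i j] by force
  ultimately have "reducible_mat A"
    using assms(1,2) reducible_mat_iff_closed_subset[OF carrier] by blast
  with irreducible show False ..
qed

text \<open>The set of vertices reachable from \<open>i\<close> contains \<open>i\<close> by the
  empty walk and is left by no edge, so irreducibility makes it everything.\<close>

lemma connected:
  assumes "i < n" "j < n"
  obtains p where "0 < pw p i j"
proof -
  have "{j. j < n \<and> (\<exists>p. 0 < pw p i j)} = {..<n}"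
  proof (rule closed_subset_eq)
    have "0 < pw 0 i i" using pw_0 assms by simp
    then show "{j. j < n \<and> (\<exists>p. 0 < pw p i j)} \<noteq> {}" using assms by blast
  next
    fix j l assume "j \<in> {j. j < n \<and> (\<exists>p. 0 < pw p i j)}" "l < n" "0 < A $$ (j, l)"
    then obtain p where j: "j < n" "0 < pw p i j" "0 < pw (Suc 0) j l" by (auto simp: pw_1)
    then have "0 < pw (p + Suc 0) i l" using pw_pos_trans assms \<open>l < n\<close> by blast
    then show "l \<in> {j. j < n \<and> (\<exists>p. 0 < pw p i j)}" using \<open>l < n\<close> by blast
  qed auto
  then show ?thesis using assms that by blast
qed

lemma connected_pos:
  assumes "i < n" "j < n" "i \<noteq> j"
  obtains p where "0 < p" "0 < pw p i j"
proof -
  obtain p where p: "0 < pw p i j" using connected assms by blast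
  then have "p \<noteq> 0" using pw_0[of i j] assms by (cases p) auto
  with p that show ?thesis by blast
qed

text \<open>Because \<open>n\<close> is at least 2 there is a second index, and the walk towards it
  begins with an edge out of \<open>i\<close>.\<close>

lemma successor:
  assumes "i < n"
  obtains j where "j < n" "0 < A $$ (i, j)"
proof -
  define l :: nat where "l = (if i = 0 then 1 else 0)"
  have l: "l < n" "i \<noteq> l" using two_le by (auto simp: l_def)
  then obtain p where p: "0 < p" "0 < pw p i l" using connected_pos assms by blast
  then have "p = Suc 0 + (p - 1)" by simp
  then obtain j where "j < n" "0 < pw (Suc 0) i j"
    using pw_pos_split[of i l "Suc 0" "p - 1"] p assms l by metis
  then show ?thesis using that assms pw_1 by simp
qed

section \<open>Action of the powers on vectors\<close>

lemma act_cong: "(\<And>j. j < n \<Longrightarrow> x j = y j) \<Longrightarrow> act p x i = act p y i"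
  unfolding act_def by (rule sum.cong) auto

lemma act_0: "i < n \<Longrightarrow> act 0 x i = x i"
proof -
  assume i: "i < n"
  have "act 0 x i = (\<Sum>j<n. if i = j then x j else 0)"
    unfolding act_def using i by (intro sum.cong) (auto simp: pw_0)
  then show ?thesis using i by (simp add: sum.delta')
qed

lemma act_add:
  assumes "i < n"
  shows "act (p + q) x i = act p (act q x) i"
proof -
  have "act (p + q) x i = (\<Sum>j<n. \<Sum>l<n. pw p i l * pw q l j * x j)"
    unfolding act_def using assms by (intro sum.cong) (auto simp: pw_add sum_distrib_right)
  also have "\<dots> = (\<Sum>l<n. \<Sum>j<n. pw p i l * pw q l j * x j)" by (rule sum.swap)
  also have "\<dots> = act p (act q x) i" by (simp add: act_def sum_distrib_left mult.assoc)
  finally show ?thesis .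
qed

lemma act_diff_scaled: "act p (\<lambda>j. x j - c * y j) i = act p x i - c * act p y i"
  by (simp add: act_def right_diff_distrib sum_subtractf sum_distrib_left mult_ac)

lemma act_scaled: "act p (\<lambda>j. c * y j) i = c * act p y i"
  by (simp add: act_def sum_distrib_left mult_ac)

lemma act_nonneg: "i < n \<Longrightarrow> (\<And>j. j < n \<Longrightarrow> 0 \<le> x j) \<Longrightarrow> 0 \<le> act p x i"
  unfolding act_def by (intro sum_nonneg mult_nonneg_nonneg pw_nonneg) auto

lemma act_pos:
  assumes "i < n" "\<And>j. j < n \<Longrightarrow> 0 \<le> x j" "j < n" "0 < pw p i j" "0 < x j"
  shows "0 < act p x i"
  unfolding act_def
  by (rule sum_pos2[of _ j]) (use assms pw_nonneg in auto)

lemma act_eigenvector_pow: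
  assumes "\<And>i. i < n \<Longrightarrow> act q x i = c * x i" and "i < n"
  shows "act (q * t) x i = c ^ t * x i"
  using \<open>i < n\<close>
proof (induction t arbitrary: i)
  case 0
  then show ?case by (simp add: act_0)
next
  case (Suc t)
  have "act (q * Suc t) x i = act (q * t) (act q x) i"
    using act_add[OF Suc.prems, of "q * t" q] by (simp add: add.commute)
  also have "\<dots> = act (q * t) (\<lambda>j. c * x j) i" by (rule act_cong) (rule assms(1))
  finally show ?case using Suc by (simp add: act_scaled)
qed

text \<open>
  Applying \<open>I + A + \<dots> + A\<^sup>K\<^sup>-\<^sup>1\<close> with \<open>K\<close> large makes \<open>y\<close> positive and every
  inequality strict, which contradicts the bound for positive vectors.
\<close>

lemma supereigenvector_eq:
  assumes y: "\<And>i. i < n \<Longrightarrow> 0 \<le> y i" "\<exists>i<n. 0 < y i"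
    and super: "\<And>i. i < n \<Longrightarrow> \<rho> * y i \<le> act 1 y i" and "i < n"
  shows "act 1 y i = \<rho> * y i"
proof (rule ccontr)
  assume "act 1 y i \<noteq> \<rho> * y i"
  with super \<open>i < n\<close> have strict: "0 < act 1 y i - \<rho> * y i" by fastforce
  obtain j where j: "j < n" "0 < y j" using y(2) by blast
  have "\<forall>l k. \<exists>p. l < n \<longrightarrow> k < n \<longrightarrow> 0 < pw p l k" using connected by blast
  then obtain f where f: "\<And>l k. l < n \<Longrightarrow> k < n \<Longrightarrow> 0 < pw (f l k) l k" by metis
  \<comment> \<open>\<open>K\<close> exceeds the length of the walk chosen for each pair, so every
    pair is joined by a walk of length less than \<open>K\<close>.\<close>
  define K where "K = Suc (\<Sum>l<n. \<Sum>k<n. f l k)"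
  have fK: "f l k < K" if "l < n" "k < n" for l k
  proof -
    have "f l k \<le> (\<Sum>k<n. f l k)" by (rule member_le_sum) (use that in auto)
    also have "\<dots> \<le> (\<Sum>l<n. \<Sum>k<n. f l k)"
      by (rule member_le_sum[of l "{..<n}" "\<lambda>l. \<Sum>k<n. f l k"]) (use that in auto)
    finally show ?thesis by (simp add: K_def)
  qed
  define z where "z l = (\<Sum>p<K. act p y l)" for l
  have z: "0 < z l" if "l < n" for l unfolding z_def
    by (rule sum_pos2[of _ "f l j"])
      (use that j fK y f in \<open>auto intro!: act_pos[of l y j] act_nonneg\<close>)
  have "\<rho> * z l < act 1 z l" if l: "l < n" for l
  proof -
    \<comment> \<open>\<open>A\<close> commutes with its powers, so the defect of \<open>z\<close>
      is the same sum of powers applied to the defect of \<open>y\<close>, which is nonnegative and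
      positive at \<open>i\<close>.\<close>
    have "act 1 z l = (\<Sum>p<K. act 1 (act p y) l)"
      unfolding z_def act_def[of 1] by (simp add: sum_distrib_left sum.swap[of _ "{..<K}"])
    also have "\<dots> = (\<Sum>p<K. act p (act 1 y) l)"
      using act_add[OF l, of 1 _ y] act_add[OF l, of _ 1 y] by (simp add: add.commute)
    finally have "act 1 z l - \<rho> * z l = (\<Sum>p<K. act p (\<lambda>k. act 1 y k - \<rho> * y k) l)"
      by (simp add: z_def act_diff_scaled sum_subtractf sum_distrib_left)
    also have "0 < \<dots>"
      by (rule sum_pos2[of _ "f l i"])
        (use l \<open>i < n\<close> fK f super strict in \<open>auto intro!: act_pos[of l _ i] act_nonneg\<close>)
    finally show ?thesis by simp
  qed
  then have gt: "\<rho> < act 1 z l / z l" if "l < n" for l using z that by (simp add: pos_less_divide_eq)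
  define \<mu> where "\<mu> = Min ((\<lambda>l. act 1 z l / z l) ` {..<n})"
  have ne: "(\<lambda>l. act 1 z l / z l) ` {..<n} \<noteq> {}" using n_pos by auto
  have "\<rho> < \<mu>" unfolding \<mu>_def using ne gt by (subst Min_gr_iff) auto
  moreover have "\<mu> \<le> \<rho>" unfolding \<rho>_def
  proof (rule positive_supereigenvector_le_spectral_radius[OF carrier entry_nonneg n_pos z])
    fix l assume l: "l < n"
    have "\<mu> \<le> act 1 z l / z l" unfolding \<mu>_def by (rule Min_le) (use l in auto)
    then have "\<mu> * z l \<le> act 1 z l" using z[OF l] by (simp add: pos_le_divide_eq)
    also have "\<dots> = (\<Sum>j<n. A $$ (l, j) * z j)" using l by (simp add: act_def pw_1)
    finally show "\<mu> * z l \<le> (\<Sum>j<n. A $$ (l, j) * z j)" .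
  qed
  ultimately show False by simp
qed

text \<open>A walk of length \<open>p\<close> from \<open>i\<close> to a positive coordinate makes
  \<open>act p y i\<close> positive, and that equals \<open>c ^ p * y i\<close>.\<close>

lemma nonneg_eigenvector_pos:
  assumes y: "\<And>i. i < n \<Longrightarrow> 0 \<le> y i" "\<exists>i<n. 0 < y i"
    and eig: "\<And>i. i < n \<Longrightarrow> act 1 y i = c * y i" and "i < n"
  shows "0 < y i"
proof -
  obtain j where j: "j < n" "0 < y j" using y(2) by blast
  then obtain p where "0 < pw p i j" using connected \<open>i < n\<close> by blast
  then have "0 < act p y i" using act_pos y j \<open>i < n\<close> by blast
  then have "y i \<noteq> 0" using act_eigenvector_pow[OF eig \<open>i < n\<close>, where t = p] by auto
  with y(1)[OF \<open>i < n\<close>] show ?thesis by simp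
qed

text \<open>The triangle inequality makes the vector of moduli a supereigenvector for
  \<open>\<rho>\<close>; \<open>supereigenvector_eq\<close> then leaves only equality.\<close>

lemma peripheral_eigenvector_modulus:
  assumes v: "\<exists>i<n. v i \<noteq> 0"
      "\<And>i. i < n \<Longrightarrow> (\<Sum>j<n. complex_of_real (A $$ (i, j)) * v j) = ev * v i"
    and ev: "cmod ev = \<rho>" and "i < n"
  shows "act 1 (\<lambda>j. cmod (v j)) i = \<rho> * cmod (v i)" and "0 < cmod (v i)"
proof -
  have super: "\<rho> * cmod (v i) \<le> act 1 (\<lambda>j. cmod (v j)) i" if "i < n" for i
  proof -
    have "\<rho> * cmod (v i) = cmod (\<Sum>j<n. complex_of_real (A $$ (i, j)) * v j)"
      using v(2)[OF that] ev by (simp add: norm_mult)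
    also have "\<dots> \<le> (\<Sum>j<n. cmod (complex_of_real (A $$ (i, j)) * v j))" by (rule norm_sum)
    also have "\<dots> = act 1 (\<lambda>j. cmod (v j)) i"
      unfolding act_def using that by (intro sum.cong) (auto simp: norm_mult entry_nonneg pw_1)
    finally show ?thesis .
  qed
  have pos: "\<exists>i<n. 0 < cmod (v i)" using v(1) by simp
  have eq: "act 1 (\<lambda>j. cmod (v j)) i = \<rho> * cmod (v i)" if "i < n" for i
    by (rule supereigenvector_eq[OF _ pos super that]) auto
  then show "act 1 (\<lambda>j. cmod (v j)) i = \<rho> * cmod (v i)" using \<open>i < n\<close> .
  show "0 < cmod (v i)" by (rule nonneg_eigenvector_pos[OF _ pos eq \<open>i < n\<close>]) auto
qed

text \<open>The moduli of an eigenvector for any eigenvalue of largest modulus will do; in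
  particular \<open>\<rho>\<close> itself is an eigenvalue.\<close>

lemma perron_vector:
  obtains w where "\<And>i. i < n \<Longrightarrow> 0 < w i" "\<And>i. i < n \<Longrightarrow> act 1 w i = \<rho> * w i"
proof -
  obtain ev where ev: "ev \<in> spectrum (map_mat complex_of_real A)" "cmod ev = \<rho>"
    using real_spectral_radius_attained[OF carrier n_pos] unfolding \<rho>_def by blast
  then obtain v where v: "\<exists>i<n. v i \<noteq> 0"
      "\<forall>i<n. (\<Sum>j<n. complex_of_real (A $$ (i, j)) * v j) = ev * v i"
    using mem_complex_spectrum_iff[OF carrier] by blast
  show ?thesis
    by (rule that[of "\<lambda>i. cmod (v i)"]; rule peripheral_eigenvector_modulus[OF v(1) _ ev(2)]) (use v(2) in auto)
qed

lemma spectral_radius_pos: "0 < \<rho>"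
proof -
  obtain w where w: "\<And>i. i < n \<Longrightarrow> 0 < w i" "\<And>i. i < n \<Longrightarrow> act 1 w i = \<rho> * w i"
    using perron_vector by blast
  obtain j where j: "j < n" "0 < A $$ (0, j)" using successor n_pos by blast
  have "0 < act 1 w 0" by (rule act_pos[of 0 w j]) (use w(1) j n_pos in \<open>auto simp: pw_1 intro: less_imp_le\<close>)
  then show ?thesis using w n_pos by (simp add: zero_less_mult_iff) (metis order_less_asym)
qed

text \<open>The complement of a closed set of the transpose is closed for \<open>A\<close>.\<close>

lemma transpose: "nonneg_irreducible A\<^sup>T n"
proof
  have T: "A\<^sup>T \<in> carrier_mat n n" using carrier by simp
  show "irreducible_mat A\<^sup>T"
  proof
    assume "reducible_mat A\<^sup>T"
    then obtain S where S: "S \<subseteq> {..<n}" "S \<noteq> {}" "S \<noteq> {..<n}"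
      "\<forall>i\<in>S. \<forall>j\<in>{..<n} - S. A\<^sup>T $$ (i, j) = 0"
      using reducible_mat_iff_closed_subset[OF T] by blast
    have "{..<n} - S = {..<n}"
    proof (rule closed_subset_eq)
      fix i j assume "i \<in> {..<n} - S" "j < n" "0 < A $$ (i, j)"
      then show "j \<in> {..<n} - S" using S(4) carrier by fastforce
    qed (use S in auto)
    then show False using S by blast
  qed
qed (use carrier two_le nonneg in \<open>auto simp: nonnegative_mat_def\<close>)

lemma left_perron_vector:
  obtains u where "\<And>i. i < n \<Longrightarrow> 0 < u i"
    "\<And>p j. j < n \<Longrightarrow> (\<Sum>i<n. u i * pw p i j) = \<rho> ^ p * u j"
proof -
  interpret T: nonneg_irreducible "A\<^sup>T" n by (rule transpose)
  obtain u where u: "\<And>i. i < n \<Longrightarrow> 0 < u i" "\<And>i. i < n \<Longrightarrow> T.act 1 u i = T.\<rho> * u i"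
    using T.perron_vector by blast
  obtain w where w: "\<And>i. i < n \<Longrightarrow> 0 < w i" "\<And>i. i < n \<Longrightarrow> act 1 w i = \<rho> * w i"
    using perron_vector by blast
  have left: "(\<Sum>i<n. u i * A $$ (i, j)) = T.\<rho> * u j" if "j < n" for j
    using u(2)[OF that] that carrier by (simp add: T.act_def T.pw_1 mult.commute)
  \<comment> \<open>Evaluating the pairing of \<open>u\<close> with \<open>A w\<close> in two ways
    identifies the two Perron roots, since two positive vectors have a nonzero pairing.\<close>
  have "T.\<rho> * (\<Sum>j<n. u j * w j) = (\<Sum>j<n. (\<Sum>i<n. u i * A $$ (i, j)) * w j)"
    by (simp add: left sum_distrib_left mult_ac)
  also have "\<dots> = (\<Sum>i<n. \<Sum>j<n. u i * A $$ (i, j) * w j)"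
    by (subst sum.swap) (simp add: sum_distrib_right)
  also have "\<dots> = (\<Sum>i<n. u i * act 1 w i)"
    by (simp add: act_def pw_1 sum_distrib_left mult_ac)
  also have "\<dots> = \<rho> * (\<Sum>j<n. u j * w j)" by (simp add: w(2)[unfolded One_nat_def] sum_distrib_left mult_ac)
  finally have "T.\<rho> * (\<Sum>j<n. u j * w j) = \<rho> * (\<Sum>j<n. u j * w j)" .
  moreover have "0 < (\<Sum>j<n. u j * w j)" using u(1) w(1) n_pos by (intro sum_pos) auto
  ultimately have "T.\<rho> = \<rho>" by simp
  have "(\<Sum>i<n. u i * pw p i j) = \<rho> ^ p * u j" if "j < n" for p j
    using that
  proof (induction p arbitrary: j)
    case 0
    have "(\<Sum>i<n. u i * pw 0 i j) = (\<Sum>i<n. if i = j then u i else 0)"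
      using 0 by (intro sum.cong) (auto simp: pw_0)
    then show ?case using 0 by (simp add: sum.delta)
  next
    case (Suc p)
    have "(\<Sum>i<n. u i * pw (Suc p) i j) = (\<Sum>i<n. \<Sum>l<n. u i * pw p i l * A $$ (l, j))"
      using pw_add[OF _ Suc.prems, of _ p 1] Suc.prems
      by (simp add: pw_1 sum_distrib_left mult_ac)
    also have "\<dots> = (\<Sum>l<n. (\<Sum>i<n. u i * pw p i l) * A $$ (l, j))"
      by (subst sum.swap) (simp add: sum_distrib_right)
    also have "\<dots> = \<rho> ^ p * (\<Sum>l<n. u l * A $$ (l, j))"
      by (simp add: Suc.IH sum_distrib_left mult_ac)
    finally show ?case using left[OF Suc.prems] \<open>T.\<rho> = \<rho>\<close> by simp
  qed
  with u(1) show ?thesis using that by blast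
qed

text \<open>Weighted by a positive left eigenvector, the differences of the two sides sum to zero;
  having one common sign, they all vanish.\<close>

lemma semieigenvector_eq:
  assumes "(\<forall>i<n. act p x i \<le> \<rho> ^ p * x i) \<or> (\<forall>i<n. \<rho> ^ p * x i \<le> act p x i)" and "i < n"
  shows "act p x i = \<rho> ^ p * x i"
proof -
  obtain u where u: "\<And>i. i < n \<Longrightarrow> 0 < u i"
    "\<And>p j. j < n \<Longrightarrow> (\<Sum>i<n. u i * pw p i j) = \<rho> ^ p * u j"
    using left_perron_vector by blast
  have "(\<Sum>i<n. u i * act p x i) = (\<Sum>i<n. \<Sum>j<n. u i * pw p i j * x j)"
    by (simp add: act_def sum_distrib_left mult_ac)
  also have "\<dots> = (\<Sum>j<n. (\<Sum>i<n. u i * pw p i j) * x j)"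
    by (subst sum.swap) (simp add: sum_distrib_right)
  also have "\<dots> = (\<Sum>i<n. u i * (\<rho> ^ p * x i))" using u(2) by (simp add: mult_ac)
  finally have sum0: "(\<Sum>i<n. u i * (act p x i - \<rho> ^ p * x i)) = 0"
    by (simp add: right_diff_distrib sum_subtractf)
  from assms(1) have "u i * (act p x i - \<rho> ^ p * x i) = 0"
  proof
    assume le: "\<forall>i<n. \<rho> ^ p * x i \<le> act p x i"
    have "\<forall>i\<in>{..<n}. u i * (act p x i - \<rho> ^ p * x i) = 0"
      using sum0 by (subst (asm) sum_nonneg_eq_0_iff) (use le u(1) in \<open>auto simp: less_imp_le\<close>)
    then show ?thesis using \<open>i < n\<close> by blast
  next
    assume le: "\<forall>i<n. act p x i \<le> \<rho> ^ p * x i"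
    have "(\<Sum>i<n. u i * (\<rho> ^ p * x i - act p x i)) = - (\<Sum>i<n. u i * (act p x i - \<rho> ^ p * x i))"
      by (simp add: right_diff_distrib sum_subtractf)
    then have "(\<Sum>i<n. u i * (\<rho> ^ p * x i - act p x i)) = 0" using sum0 by simp
    then have "\<forall>i\<in>{..<n}. u i * (\<rho> ^ p * x i - act p x i) = 0"
      by (subst (asm) sum_nonneg_eq_0_iff) (use le u(1) in \<open>auto simp: less_imp_le\<close>)
    then show ?thesis using \<open>i < n\<close> by auto
  qed
  then show ?thesis using u(1)[OF \<open>i < n\<close>] by simp
qed

end

section \<open>Lengths of walks and cyclic partitions\<close>

text \<open>The residues modulo \<open>T\<close> of a submonoid form a group, since \<open>t\<close>
  has the inverse \<open>(T - 1) * t\<close>. This group is generated by the gcd of \<open>T\<close>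
  and the elements of \<open>S\<close>; hypothesis \<open>L\<close> makes that gcd divide
  \<open>L\<close>, so the residue of \<open>- L\<close> is attained.\<close>

lemma submonoid_hits_residue:
  fixes S :: "nat set"
  assumes zero: "0 \<in> S" and add: "\<And>s t. s \<in> S \<Longrightarrow> t \<in> S \<Longrightarrow> s + t \<in> S" and T: "0 < T"
    and L: "\<And>e. (\<And>s. s \<in> S \<Longrightarrow> e dvd s) \<Longrightarrow> e dvd T \<Longrightarrow> e dvd L"
  shows "\<exists>s\<in>S. T dvd L + s"
proof -
  have mult: "k * s \<in> S" if "s \<in> S" for k s
    by (induction k) (use zero add that in auto)
  \<comment> \<open>\<open>H\<close> is the preimage in the integers of the residues of
    \<open>S\<close>, and will be an ideal.\<close>
  define H where "H = {x::int. \<exists>s\<in>S. int T dvd x - int s}"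
  have H: "x + c * y \<in> H" if xy: "x \<in> H" "y \<in> H" for x y c
  proof -
    obtain s t where st: "s \<in> S" "t \<in> S" "int T dvd x - int s" "int T dvd y - int t"
      using xy unfolding H_def by blast
    \<comment> \<open>An integer coefficient is replaced by its nonnegative residue modulo
      \<open>T\<close>, because only natural multiples are known to stay in
      \<open>S\<close>.\<close>
    define k where "k = nat (c mod int T)"
    have k: "int k = c mod int T" using T by (simp add: k_def)
    have "int T dvd (c - int k) * int t" using k by (simp add: dvd_mult2 minus_mod_eq_mult_div)
    then have "int T dvd (x - int s) + c * (y - int t) + (c - int k) * int t"
      using st by (intro dvd_add) auto
    also have "(x - int s) + c * (y - int t) + (c - int k) * int t = x + c * y - int (s + k * t)"
      by (simp add: algebra_simps)
    finally show ?thesis using add[OF st(1) mult[OF st(2), of k]] unfolding H_def by blast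
  qed
  have S_H: "int s \<in> H" if "s \<in> S" for s
    unfolding H_def using that by (intro CollectI bexI[of _ s]) auto
  have T_H: "int T \<in> H" using zero by (force simp: H_def)
  \<comment> \<open>The least positive element generates \<open>H\<close>; this follows by division
    with remainder.\<close>
  define g where "g = (LEAST g. 0 < g \<and> int g \<in> H)"
  have g: "0 < g" "int g \<in> H"
    using LeastI[of "\<lambda>g. 0 < g \<and> int g \<in> H" T] T T_H by (auto simp: g_def)
  have dvd: "int g dvd x" if "x \<in> H" for x
  proof -
    have "x mod int g = x + (- (x div int g)) * int g" by (simp add: minus_div_mult_eq_mod[symmetric])
    then have "x mod int g \<in> H" using H[OF that g(2), of "- (x div int g)"] by simp
    moreover have "x mod int g < int g" "0 \<le> x mod int g" using g by auto
    ultimately have "\<not> 0 < nat (x mod int g)"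
      using not_less_Least[of "nat (x mod int g)" "\<lambda>g. 0 < g \<and> int g \<in> H"] unfolding g_def[symmetric] by auto
    then have "x mod int g = 0" using \<open>0 \<le> x mod int g\<close> by simp
    then show ?thesis by auto
  qed
  have "g dvd s" if "s \<in> S" for s using dvd[OF S_H[OF that]] by (simp only: int_dvd_int_iff)
  moreover have "g dvd T" using dvd[OF T_H] by (simp only: int_dvd_int_iff)
  ultimately have "g dvd L" by (rule L)
  then obtain k where "L = g * k" ..
  then have "- int L \<in> H" using H[of 0 "int g" "- int k"] S_H[OF zero] g(2) by (simp add: mult.commute)
  then obtain s where s: "s \<in> S" "int T dvd - int L - int s" by (auto simp: H_def)
  then have "int T dvd - int (L + s)" by (simp add: algebra_simps)
  then have "T dvd L + s" by (simp only: dvd_minus_iff int_dvd_int_iff)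
  with s show ?thesis by blast
qed

section \<open>The period and the cyclic classes\<close>

context nonneg_irreducible
begin

text \<open>Length 0 belongs to the set but leaves the gcd unchanged. The resulting number is shown
  later to be the index of imprimitivity.\<close>

definition period :: nat where
  "period = Gcd {p. \<exists>i<n. 0 < pw p i i}"

lemma period_dvd_closed_walk: "i < n \<Longrightarrow> 0 < pw p i i \<Longrightarrow> period dvd p"
  unfolding period_def by (rule Gcd_dvd) blast

text \<open>Closed walks at one vertex suffice: a closed walk at \<open>j\<close> can be spliced
  into a round trip from \<open>i\<close> through \<open>j\<close>, which lengthens it by exactly
  \<open>p\<close>.\<close>

lemma dvd_period:
  assumes i: "i < n" and g: "\<And>p. 0 < pw p i i \<Longrightarrow> g dvd p"
  shows "g dvd period"
  unfolding period_def
proof (rule Gcd_greatest)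
  fix p assume "p \<in> {p. \<exists>i<n. 0 < pw p i i}"
  then obtain j where j: "j < n" "0 < pw p j j" by blast
  obtain s where s: "0 < pw s i j" using connected i j(1) by blast
  obtain t where t: "0 < pw t j i" using connected i j(1) by blast
  have "g dvd s + t" by (rule g, rule pw_pos_trans[OF i j(1) i s t])
  moreover have "g dvd (s + p) + t"
    by (rule g, rule pw_pos_trans[OF i j(1) i pw_pos_trans[OF i j(1) j(1) s j(2)] t])
  then have "g dvd (s + t) + p" by (simp add: ac_simps)
  ultimately show "g dvd p" using dvd_add_right_iff by blast
qed

text \<open>A round trip between two distinct vertices is a closed walk of positive length.\<close>

lemma period_pos: "0 < period"
proof -
  have l: "(0::nat) < n" "1 < n" "(0::nat) \<noteq> 1" using two_le by auto
  obtain s where s: "0 < s" "0 < pw s 0 1" using connected_pos[OF l] by blast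
  obtain t where t: "0 < pw t 1 0" using connected l by blast
  have "period dvd s + t" by (rule period_dvd_closed_walk[OF l(1) pw_pos_trans[OF l(1,2,1) s(2) t]])
  then show ?thesis using s(1) by (auto intro: Nat.gr0I)
qed

text \<open>One return walk from \<open>j\<close> closes both walks, and the period divides both
  total lengths.\<close>

lemma walk_lengths_cong:
  assumes i: "i < n" and j: "j < n" and p: "0 < pw p i j" and q: "0 < pw q i j"
  shows "[p = q] (mod period)"
proof -
  obtain s where s: "0 < pw s j i" using connected i j by blast
  have "period dvd p + s" "period dvd q + s"
    using period_dvd_closed_walk[OF i] pw_pos_trans[OF i j i] p q s by auto
  then have "[p + s = q + s] (mod period)" by (simp add: cong_def mod_eq_0_iff_dvd)
  then show ?thesis by (simp only: cong_add_rcancel_nat)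
qed

text \<open>The lengths of closed walks at \<open>j\<close> form a submonoid; appending a suitable
  one brings the length to a multiple of \<open>T\<close>. This supplies the connectivity of
  \<open>A ^\<^sub>m T\<close> inside a class.\<close>

lemma walk_of_multiple_length:
  assumes i: "i < n" and j: "j < n" and T: "0 < T" and L: "0 < pw L i j" "gcd period T dvd L"
  obtains t where "0 < pw (T * t) i j"
proof -
  have "\<exists>s\<in>{p. 0 < pw p j j}. T dvd L + s"
  proof (rule submonoid_hits_residue[OF _ _ T])
    fix e assume "\<And>s. s \<in> {p. 0 < pw p j j} \<Longrightarrow> e dvd s" "e dvd T"
    then have "e dvd gcd period T" using dvd_period[OF j] by simp
    then show "e dvd L" using L(2) by (rule dvd_trans)
  qed (use pw_0 pw_pos_trans j in auto)
  then obtain s where "0 < pw s j j" "T dvd L + s" by blast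
  then show ?thesis using pw_pos_trans[OF i j j L(1)] that by (metis dvdE)
qed

lemma class_number_less: "cyclic_partition A r m \<Longrightarrow> i < n \<Longrightarrow> m i < r"
  using carrier by (auto simp: cyclic_partition_def)

lemma cyclic_partition_walk:
  assumes m: "cyclic_partition A r m" and i: "i < n" and j: "j < n" and "0 < pw p i j"
  shows "m j = (m i + p) mod r"
  using j \<open>0 < pw p i j\<close>
proof (induction p arbitrary: j)
  case 0
  then show ?case using class_number_less[OF m i] 0 i pw_0[of i j] by (auto split: if_splits)
next
  case (Suc p)
  obtain l where l: "l < n" "0 < pw p i l" "0 < pw (Suc 0) l j"
    using pw_pos_split[OF i Suc.prems(1), of p "Suc 0"] Suc.prems(2) by auto
  then have "m j = Suc (m l) mod r"
    using m Suc.prems(1) carrier by (simp add: cyclic_partition_def pw_1)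
  also have "\<dots> = Suc (m i + p) mod r" using Suc.IH[OF l(1,2)] by (simp add: mod_Suc_eq)
  finally show ?case by simp
qed

lemma walk_exists:
  assumes "i < n"
  shows "\<exists>j<n. 0 < pw p i j"
proof (induction p)
  case 0
  then show ?case using assms pw_0[of i i] by auto
next
  case (Suc p)
  then obtain j where j: "j < n" "0 < pw p i j" by blast
  obtain l where l: "l < n" "0 < A $$ (j, l)" using successor j(1) by blast
  then have "0 < pw (p + Suc 0) i l" using pw_pos_trans[OF assms j(1) l(1) j(2), of "Suc 0"] j pw_1 by simp
  then show ?case using l by auto
qed

text \<open>A vertex is classed by the length modulo \<open>r\<close> of walks to it from 0, which
  is well defined by \<open>walk_lengths_cong\<close>.\<close>

lemma cyclic_partition_exists:
  assumes r: "r dvd period"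
  shows "\<exists>m. cyclic_partition A r m"
proof -
  have r0: "0 < r" using r period_pos by (auto intro: Nat.gr0I)
  define m where "m j = (SOME p. 0 < pw p 0 j) mod r" for j
  have m: "m j = p mod r" if "j < n" "0 < pw p 0 j" for j p
  proof -
    have "0 < pw (SOME p. 0 < pw p 0 j) 0 j" using that(2) by (rule someI)
    then have "[(SOME p. 0 < pw p 0 j) = p] (mod period)"
      using walk_lengths_cong[OF n_pos that(1)] that(2) by blast
    then have "[(SOME p. 0 < pw p 0 j) = p] (mod r)" using r by (rule cong_dvd_modulus_nat)
    then show ?thesis by (simp add: m_def cong_def)
  qed
  have "l \<in> m ` {..<n}" if "l < r" for l
  proof -
    obtain j where "j < n" "0 < pw l 0 j" using walk_exists[OF n_pos] by blast
    then show ?thesis using m that by force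
  qed
  moreover have "m ` {..<n} \<subseteq> {..<r}" using r0 by (auto simp: m_def)
  ultimately have "m ` {..<n} = {..<r}" by blast
  moreover have "m j = Suc (m i) mod r" if ij: "i < n" "j < n" "0 < A $$ (i, j)" for i j
  proof -
    obtain p where p: "0 < pw p 0 i" using connected n_pos ij(1) by blast
    then have "0 < pw (p + Suc 0) 0 j"
      using pw_pos_trans[OF n_pos ij(1,2) p, of "Suc 0"] ij pw_1 by simp
    then show ?thesis using m[OF ij(2)] m[OF ij(1) p] by (simp add: mod_Suc_eq)
  qed
  ultimately show ?thesis using carrier by (auto simp: cyclic_partition_def)
qed

text \<open>For a gcd above 1, \<open>T\<close> steps return to the same class, so one class is
  closed for the power. Otherwise any walk can be prolonged to a length divisible by
  \<open>T\<close>, so a nonempty closed set exhausts all vertices.\<close>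

lemma reducible_pow_iff:
  assumes T: "0 < T"
  shows "reducible_mat (A ^\<^sub>m T) \<longleftrightarrow> 1 < gcd period T"
proof -
  let ?r = "gcd period T"
  have pwT: "A ^\<^sub>m T \<in> carrier_mat n n" using carrier by simp
  have r0: "0 < ?r" using T by simp
  show ?thesis
  proof
    assume "1 < ?r"
    obtain m where m: "cyclic_partition A ?r m"
      using cyclic_partition_exists[OF gcd_dvd1[of period T]] by (elim exE)
    define S where "S = {i. i < n \<and> m i = 0}"
    have im: "m ` {..<n} = {..<?r}" using m carrier by (auto simp: cyclic_partition_def)
    have "0 \<in> m ` {..<n}" "1 \<in> m ` {..<n}" unfolding im using \<open>1 < ?r\<close> by (simp_all only: lessThan_iff r0)
    then obtain a b where "a < n" "m a = 0" "b < n" "m b = 1" by (metis imageE lessThan_iff)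
    then have "a \<in> S" "b \<in> {..<n} - S" by (simp_all add: S_def)
    then have "S \<subseteq> {..<n}" "S \<noteq> {}" "S \<noteq> {..<n}" unfolding S_def by blast+
    moreover have "(A ^\<^sub>m T) $$ (i, j) = 0" if "i \<in> S" "j \<in> {..<n} - S" for i j
    proof (rule ccontr)
      assume "(A ^\<^sub>m T) $$ (i, j) \<noteq> 0"
      moreover have ij: "i < n" "j < n" "m i = 0" using that by (auto simp: S_def)
      ultimately have "0 < pw T i j" using pw_nonneg[OF ij(1,2), of T] by (simp add: pw_def)
      then have "m j = T mod ?r" using cyclic_partition_walk[OF m ij(1,2)] ij(3) by simp
      then have "m j = 0" using dvd_imp_mod_0[of ?r T] by simp
      then show False using that ij by (auto simp: S_def)
    qed
    ultimately show "reducible_mat (A ^\<^sub>m T)"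
      using reducible_mat_iff_closed_subset[OF pwT] by blast
  next
    assume "reducible_mat (A ^\<^sub>m T)"
    then obtain S where S: "S \<subseteq> {..<n}" "S \<noteq> {}" "S \<noteq> {..<n}"
      "\<And>i j. i \<in> S \<Longrightarrow> j \<in> {..<n} - S \<Longrightarrow> pw T i j = 0"
      using reducible_mat_iff_closed_subset[OF pwT] unfolding pw_def by blast
    have closed: "j \<in> S" if i: "i \<in> S" "j < n" "0 < pw (T * t) i j" for i j t
      using i(2,3)
    proof (induction t arbitrary: j)
      case 0
      then show ?case using i(1) S(1) pw_0[of i j] by (auto split: if_splits)
    next
      case (Suc t)
      have "i < n" using i(1) S(1) by auto
      have "0 < pw (T * t + T) i j" using Suc.prems by (simp add: add.commute)
      then obtain l where l: "l < n" "0 < pw (T * t) i l" "0 < pw T l j"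
        using pw_pos_split[OF \<open>i < n\<close> Suc.prems(1)] by metis
      then have "l \<in> S" using Suc.IH by simp
      with S(4)[of l j] l(3) Suc.prems(1) show ?case by auto
    qed
    obtain i where i: "i \<in> S" using S(2) by blast
    obtain j where j: "j < n" "j \<notin> S" using S(1,3) by blast
    show "1 < ?r"
    proof (rule ccontr)
      assume "\<not> 1 < ?r"
      then have r1: "?r = 1" using r0 by linarith
      have "i < n" using i S(1) by auto
      then obtain L where L: "0 < pw L i j" using connected j(1) by blast
      have "?r dvd L" unfolding r1 by simp
      then obtain t where "0 < pw (T * t) i j"
        using walk_of_multiple_length[OF \<open>i < n\<close> j(1) T L] by blast
      then show False using closed i j by blast
    qed
  qed
qed

end

section \<open>The peripheral spectrum\<close>

text \<open>All exponents in \<open>S\<close> are multiples of the order of \<open>x\<close>.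
  Without a finite order only exponent 0 is possible, and then \<open>Gcd S\<close> is 0.\<close>

lemma power_Gcd_eq_1:
  fixes x :: "'a :: monoid_mult"
  assumes "\<And>p. p \<in> S \<Longrightarrow> x ^ p = 1"
  shows "x ^ Gcd S = 1"
proof (cases "\<exists>p>0. x ^ p = 1")
  case True
  define o' where "o' = (LEAST p. 0 < p \<and> x ^ p = 1)"
  have o': "0 < o'" "x ^ o' = 1" using LeastI_ex[OF True] by (auto simp: o'_def)
  have "o' dvd p" if "p \<in> S" for p
  proof -
    have "x ^ (o' * (p div o') + p mod o') = 1" using assms[OF that] by simp
    then have "x ^ (p mod o') = 1" using o'(2) by (simp only: power_add power_mult power_one mult_1_left)
    then have "\<not> 0 < p mod o'"
      using not_less_Least[of "p mod o'" "\<lambda>p. 0 < p \<and> x ^ p = 1"] o'(1) unfolding o'_def[symmetric] by auto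
    then show ?thesis by auto
  qed
  then have "o' dvd Gcd S" by (rule Gcd_greatest)
  then obtain k where k: "Gcd S = o' * k" ..
  show ?thesis unfolding k power_mult o'(2) by simp
next
  case False
  have "p = 0" if "p \<in> S" for p using False assms[OF that] by auto
  then have "S \<subseteq> {0}" by auto
  then have "Gcd S = 0" by (simp add: Gcd_0_iff)
  show ?thesis unfolding \<open>Gcd S = 0\<close> by simp
qed

lemma complex_eq_cmod_if_Re_eq:
  assumes "Re q = cmod q"
  shows "q = of_real (cmod q)"
proof -
  have "(Re q)\<^sup>2 + (Im q)\<^sup>2 = (Re q)\<^sup>2" using cmod_power2[of q] assms by simp
  then show ?thesis using assms by (simp add: complex_eq_iff)
qed

context nonneg_irreducible
begin

text \<open>Equality holds in the triangle inequality for row \<open>i\<close>, so all summands with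
  a positive coefficient point in the direction of \<open>ev * v i\<close>, which is
  \<open>e\<close> after normalising.\<close>

lemma peripheral_eigenvector_phase:
  assumes v: "\<exists>i<n. v i \<noteq> 0"
      "\<And>i. i < n \<Longrightarrow> (\<Sum>j<n. complex_of_real (A $$ (i, j)) * v j) = ev * v i"
    and ev: "cmod ev = \<rho>" and ij: "i < n" "j < n" "0 < A $$ (i, j)"
  shows "v j / cmod (v j) = (ev / \<rho>) * (v i / cmod (v i))"
proof -
  have modulus: "act 1 (\<lambda>j. cmod (v j)) k = \<rho> * cmod (v k)" if "k < n" for k
    by (rule peripheral_eigenvector_modulus(1)[OF v(1) v(2) ev that])
  have pos: "0 < cmod (v k)" if "k < n" for k
    by (rule peripheral_eigenvector_modulus(2)[OF v(1) v(2) ev that])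
  define e where "e = (ev / \<rho>) * (v i / cmod (v i))"
  have vi: "0 < cmod (v i)" and vj: "0 < cmod (v j)" using pos ij by auto
  have "cmod e = 1" using ev spectral_radius_pos vi by (simp add: e_def norm_mult norm_divide)
  then have cnj_e: "cnj e * e = 1" "cmod (cnj e) = 1" by (simp_all add: complex_norm_square[symmetric] mult.commute)
  have "ev * v i = of_real (\<rho> * cmod (v i)) * e"
    using spectral_radius_pos vi by (simp add: e_def)
  \<comment> \<open>Rotating by \<open>cnj e\<close> turns row \<open>i\<close> of the eigenvalue
    equation into one with a real value, the weighted sum of the moduli.\<close>
  then have "(\<Sum>l<n. complex_of_real (A $$ (i, l)) * (cnj e * v l)) = of_real (\<rho> * cmod (v i)) * (cnj e * e)"
    using v(2)[OF ij(1)] by (simp add: sum_distrib_left[symmetric] mult.left_commute)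
  also have "\<dots> = of_real (\<Sum>l<n. A $$ (i, l) * cmod (v l))"
    using modulus[OF ij(1)] ij cnj_e by (simp add: act_def pw_1)
  finally have "Re (\<Sum>l<n. complex_of_real (A $$ (i, l)) * (cnj e * v l)) = (\<Sum>l<n. A $$ (i, l) * cmod (v l))"
    by simp
  then have "(\<Sum>l<n. A $$ (i, l) * Re (cnj e * v l)) = (\<Sum>l<n. A $$ (i, l) * cmod (v l))"
    by (simp only: Re_sum Re_complex_of_real Im_complex_of_real mult_zero_left diff_0_right times_complex.sel(1))
  \<comment> \<open>Each summand is nonnegative, so \<open>Re (cnj e * v l)\<close> attains the
    modulus wherever the entry is positive.\<close>
  then have "(\<Sum>l<n. A $$ (i, l) * (cmod (v l) - Re (cnj e * v l))) = 0"
    by (simp add: right_diff_distrib sum_subtractf)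
  moreover have le: "Re (cnj e * v l) \<le> cmod (v l)" for l
    using complex_Re_le_cmod[of "cnj e * v l"] cnj_e(2) by (simp only: norm_mult mult_1_left)
  ultimately have "\<forall>l\<in>{..<n}. A $$ (i, l) * (cmod (v l) - Re (cnj e * v l)) = 0"
    by (subst (asm) sum_nonneg_eq_0_iff) (use ij le entry_nonneg in \<open>auto simp del: times_complex.sel\<close>)
  then have "A $$ (i, j) * (cmod (v j) - Re (cnj e * v j)) = 0" using ij(2) by blast
  then have "Re (cnj e * v j) = cmod (cnj e * v j)"
    using ij(3) cnj_e(2) by (simp add: norm_mult del: times_complex.sel)
  then have "cnj e * v j = of_real (cmod (v j))"
    using complex_eq_cmod_if_Re_eq cnj_e(2) by (metis norm_mult mult_1_left)
  then have "(cnj e * e) * v j = of_real (cmod (v j)) * e" by (simp add: mult_ac)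
  then have "v j = of_real (cmod (v j)) * e" using cnj_e(1) by simp
  then show ?thesis unfolding e_def[symmetric] using vj by (simp add: divide_eq_eq mult.commute)
qed

text \<open>The phase is multiplied by \<open>ev / \<rho>\<close> along each edge, and around a
  closed walk it must come back to its starting value.\<close>

lemma peripheral_eigenvalue_phase:
  assumes "ev \<in> spectrum (map_mat complex_of_real A)" and ev: "cmod ev = \<rho>"
  shows "(ev / \<rho>) ^ period = 1"
  unfolding period_def
proof (rule power_Gcd_eq_1)
  fix p assume "p \<in> {p. \<exists>i<n. 0 < pw p i i}"
  then obtain i where i: "i < n" "0 < pw p i i" by blast
  obtain v where v: "\<exists>i<n. v i \<noteq> 0"
      "\<And>i. i < n \<Longrightarrow> (\<Sum>j<n. complex_of_real (A $$ (i, j)) * v j) = ev * v i"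
    using assms(1) mem_complex_spectrum_iff[OF carrier] by blast
  have "v j / cmod (v j) = (ev / \<rho>) ^ p * (v i / cmod (v i))" if "j < n" "0 < pw p i j" for j
    using that
  proof (induction p arbitrary: j)
    case 0
    then show ?case using i pw_0[of i j] by (auto split: if_splits)
  next
    case (Suc p)
    obtain l where l: "l < n" "0 < pw p i l" "0 < pw (Suc 0) l j"
      using pw_pos_split[OF i(1) Suc.prems(1), of p "Suc 0"] Suc.prems(2) by auto
    then have "v j / cmod (v j) = (ev / \<rho>) * (v l / cmod (v l))"
      using peripheral_eigenvector_phase[OF v(1) v(2) ev, of l j] Suc.prems(1) pw_1 by simp
    then show ?case using Suc.IH[OF l(1,2)] by (simp only: power_Suc mult.assoc)
  qed
  then have "v i / cmod (v i) = (ev / \<rho>) ^ p * (v i / cmod (v i))" using i by blast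
  moreover have "v i / cmod (v i) \<noteq> 0"
    using peripheral_eigenvector_modulus(2)[OF v(1) v(2) ev, of i] i(1) by simp
  ultimately show "(ev / \<rho>) ^ p = 1" by (metis mult_cancel_right2)
qed

lemma peripheral_spectrum:
  "{z \<in> spectrum (map_mat complex_of_real A). cmod z = \<rho>} = (\<lambda>\<omega>. of_real \<rho> * \<omega>) ` {\<omega>. \<omega> ^ period = 1}"
proof (intro equalityI subsetI)
  fix z :: complex assume "z \<in> {z \<in> spectrum (map_mat complex_of_real A). cmod z = \<rho>}"
  then have "(z / \<rho>) ^ period = 1" "z = of_real \<rho> * (z / \<rho>)"
    using peripheral_eigenvalue_phase spectral_radius_pos by auto
  then show "z \<in> (\<lambda>\<omega>. of_real \<rho> * \<omega>) ` {\<omega>. \<omega> ^ period = 1}" by blast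
next
  fix z :: complex assume "z \<in> (\<lambda>\<omega>. of_real \<rho> * \<omega>) ` {\<omega>. \<omega> ^ period = 1}"
  then obtain \<omega> :: complex where \<omega>: "\<omega> ^ period = 1" and z: "z = of_real \<rho> * \<omega>" by blast
  have norm: "cmod \<omega> = 1" using power_eq_1_iff[OF \<omega>] period_pos by simp
  obtain w where w: "\<And>i. i < n \<Longrightarrow> 0 < w i" "\<And>i. i < n \<Longrightarrow> act 1 w i = \<rho> * w i"
    using perron_vector by blast
  obtain m where m: "cyclic_partition A period m"
    using cyclic_partition_exists[OF dvd_refl] by (elim exE)
  \<comment> \<open>The Perron vector is twisted by a power of \<open>\<omega>\<close> that is
    constant on each cyclic class; each edge then contributes one factor
    \<open>\<omega>\<close>.\<close>
  define v where "v j = \<omega> ^ m j * complex_of_real (w j)" for j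
  have "(\<Sum>j<n. complex_of_real (A $$ (i, j)) * v j) = z * v i" if i: "i < n" for i
  proof -
    have summand: "complex_of_real (A $$ (i, j)) * v j = \<omega> ^ Suc (m i) * complex_of_real (A $$ (i, j) * w j)"
      if j: "j < n" for j
    proof (cases "0 < A $$ (i, j)")
      case True
      then have "m j = Suc (m i) mod period" using m i j carrier by (simp add: cyclic_partition_def)
      \<comment> \<open>Since \<open>\<omega> ^ period = 1\<close>, the wraparound from the last
        class to the first does not change the power.\<close>
      moreover have "\<omega> ^ Suc (m i) = \<omega> ^ (period * (Suc (m i) div period) + Suc (m i) mod period)" by simp
      ultimately have "\<omega> ^ Suc (m i) = \<omega> ^ m j"
        using \<omega> by (simp only: power_add power_mult power_one mult_1_left)
      then show ?thesis by (simp only: v_def of_real_mult mult.left_commute mult.assoc)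
    next
      case False
      then have "A $$ (i, j) = 0" using entry_nonneg[OF i j] by linarith
      then show ?thesis by simp
    qed
    have "(\<Sum>j<n. complex_of_real (A $$ (i, j)) * v j) = \<omega> ^ Suc (m i) * complex_of_real (act 1 w i)"
      using i by (simp add: summand act_def pw_1 sum_distrib_left del: power_Suc)
    also have "\<dots> = z * v i" using w(2)[OF i] by (simp add: z v_def mult_ac)
    finally show ?thesis .
  qed
  moreover have "v 0 \<noteq> 0" using norm w(1)[OF n_pos] by (auto simp: v_def)
  ultimately have "z \<in> spectrum (map_mat complex_of_real A)"
    using mem_complex_spectrum_iff[OF carrier] n_pos by blast
  moreover have "cmod z = \<rho>" using norm spectral_radius_pos by (simp add: z norm_mult)
  ultimately show "z \<in> {z \<in> spectrum (map_mat complex_of_real A). cmod z = \<rho>}" by simp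
qed

lemma imprimitivity_index_eq_period: "imprimitivity_index A = period"
proof -
  have "inj_on (\<lambda>\<omega>::complex. of_real \<rho> * \<omega>) B" for B
    using spectral_radius_pos by (auto intro!: inj_onI)
  then have "imprimitivity_index A = card {\<omega>::complex. \<omega> ^ period = 1}"
    unfolding imprimitivity_index_def \<rho>_def[symmetric] peripheral_spectrum by (rule card_image)
  then show ?thesis using card_roots_unity_eq[OF period_pos] by simp
qed

end

section \<open>Row sum ratios\<close>

context nonneg_irreducible
begin

lemma finite_support_pairs: "finite (support_pairs (A ^\<^sub>m p))"
proof (rule finite_subset)
  show "support_pairs (A ^\<^sub>m p) \<subseteq> {..<n} \<times> {..<n}" using carrier by (auto simp: support_pairs_def)
qed simp

lemma mem_support_pairs: "(i, j) \<in> support_pairs (A ^\<^sub>m p) \<longleftrightarrow> i < n \<and> j < n \<and> 0 < pw p i j"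
  using carrier by (auto simp: support_pairs_def pw_def)

lemma support_pairs_nonempty: "support_pairs (A ^\<^sub>m p) \<noteq> {}"
  using walk_exists[OF n_pos, of p] mem_support_pairs n_pos by blast

lemma row_sum_pow: "row_sum (A ^\<^sub>m q) i = act q (\<lambda>_. 1) i"
  using carrier by (simp add: row_sum_def act_def pw_def)

lemma row_sum_pow_add: "i < n \<Longrightarrow> row_sum (A ^\<^sub>m (q + p)) i = act p (row_sum (A ^\<^sub>m q)) i"
  using act_add[of i p q "\<lambda>_. 1"] by (simp add: row_sum_pow[abs_def] add.commute)

lemma act_pos_vector:
  assumes i: "i < n" and x: "\<And>j. j < n \<Longrightarrow> 0 < x j"
  shows "0 < act p x i"
proof -
  obtain j where j: "j < n" "0 < pw p i j" using walk_exists[OF i] by blast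
  show ?thesis by (rule act_pos[OF i _ j]) (use x j(1) in \<open>auto intro: less_imp_le\<close>)
qed

text \<open>
  The \<open>T\<close>-th power of \<open>A\<close> is irreducible on each class, so its positive eigenvector is unique up
  to scaling there: subtract from \<open>y\<close> the largest multiple of \<open>x\<close> that keeps the difference nonnegative there.
\<close>

lemma eigenvectors_proportional_on_classes:
  assumes T: "0 < T" and r: "r = gcd period T" and m: "cyclic_partition A r m"
    and x: "\<And>i. i < n \<Longrightarrow> 0 < x i"
    and eig_x: "\<And>i. i < n \<Longrightarrow> act T x i = \<mu> * x i"
    and eig_y: "\<And>i. i < n \<Longrightarrow> act T y i = \<mu> * y i"
  shows "\<exists>c. \<forall>i<n. y i = c (m i) * x i"
proof -
  have same: "m j = m i" if "i < n" "j < n" "0 < pw (T * t) i j" for i j t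
  proof -
    have "r dvd T * t" using r by simp
    then have "(m i + T * t) mod r = m i mod r" by (auto elim!: dvdE)
    then show ?thesis using cyclic_partition_walk[OF m that] class_number_less[OF m that(1)] by simp
  qed
  define c where "c l = Min ((\<lambda>i. y i / x i) ` {i. i < n \<and> m i = l})" for l
  have "y i = c (m i) * x i" if i: "i < n" for i
  proof -
    let ?V = "{j. j < n \<and> m j = m i}"
    have fin: "finite ((\<lambda>i. y i / x i) ` ?V)" and ne: "(\<lambda>i. y i / x i) ` ?V \<noteq> {}" using i by auto
    obtain i0 where i0: "i0 < n" "m i0 = m i" "c (m i) = y i0 / x i0"
      using Min_in[OF fin ne] unfolding c_def by blast
    define w where "w j = y j - c (m i) * x j" for j
    have w_nonneg: "0 \<le> w j" if "j \<in> ?V" for j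
    proof -
      have "c (m i) \<le> y j / x j" unfolding c_def using fin that by (intro Min_le) auto
      then show ?thesis using x[of j] that by (simp add: w_def pos_le_divide_eq)
    qed
    have w_i0: "w i0 = 0" using i0 x[OF i0(1)] by (simp add: w_def)
    have "act (T * t) w i0 = \<mu> ^ t * w i0" for t
    proof (rule act_eigenvector_pow[OF _ i0(1)])
      fix j assume "j < n"
      then show "act T w j = \<mu> * w j"
        unfolding w_def act_diff_scaled using eig_x eig_y by (simp add: algebra_simps)
    qed
    then have sum0: "(\<Sum>j<n. pw (T * t) i0 j * w j) = 0" for t by (simp add: act_def w_i0)
    \<comment> \<open>Outside the class of \<open>i0\<close> the vector \<open>w\<close> may be
      negative, but there the entries of the power \<open>T * t\<close> in row \<open>i0\<close>
      vanish by \<open>same\<close>.\<close>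
    have terms: "0 \<le> pw (T * t) i0 j * w j" if "j < n" for j t
    proof (cases "0 < pw (T * t) i0 j")
      case True
      then show ?thesis using same[OF i0(1) that True] i0(2) w_nonneg that by simp
    next
      case False
      then have "pw (T * t) i0 j = 0" using pw_nonneg[OF i0(1) that, of "T * t"] by linarith
      then show ?thesis by simp
    qed
    \<comment> \<open>\<open>i0\<close> and \<open>i\<close> lie in one class, so \<open>r\<close>
      divides \<open>L\<close> and the walk extends to some length \<open>T * t\<close>; the
      corresponding summand then forces \<open>w i = 0\<close>.\<close>
    obtain L where L: "0 < pw L i0 i" using connected i0(1) i by blast
    have "m i = (m i + L) mod r" using cyclic_partition_walk[OF m i0(1) i L] i0(2) by simp
    moreover have "m i mod r = m i" using class_number_less[OF m i] by simp
    ultimately have "[m i + L = m i + 0] (mod r)" by (simp add: cong_def)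
    then have "[L = 0] (mod r)" by (simp only: cong_add_lcancel_nat)
    then have "gcd period T dvd L" using r by (simp add: cong_0_iff)
    then obtain t where t: "0 < pw (T * t) i0 i" using walk_of_multiple_length[OF i0(1) i T L] by blast
    have "pw (T * t) i0 i * w i = 0"
      using sum0[of t] by (subst (asm) sum_nonneg_eq_0_iff) (use terms i in auto)
    then show ?thesis using t by (simp add: w_def)
  qed
  then show ?thesis by blast
qed

text \<open>All walks of length \<open>p\<close> from \<open>i\<close> end in class
  \<open>(m i + p) mod r\<close>, so applying \<open>A\<close> once more contributes a single
  constant that leaves the sum.\<close>

lemma act_class_ratios:
  assumes m: "cyclic_partition A r m" and c: "\<And>i. i < n \<Longrightarrow> act 1 x i = c (m i) * x i" and "i < n"
  shows "act p x i = (\<Prod>t<p. c ((m i + t) mod r)) * x i"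
  using \<open>i < n\<close>
proof (induction p arbitrary: i)
  case 0
  then show ?case by (simp add: act_0)
next
  case (Suc p)
  have "act (Suc p) x i = act p (act 1 x) i" using act_add[OF Suc.prems, of p 1] by simp
  also have "\<dots> = (\<Sum>j<n. pw p i j * (c ((m i + p) mod r) * x j))"
    unfolding act_def[of p]
  proof (rule sum.cong)
    fix j assume "j \<in> {..<n}"
    then have j: "j < n" by simp
    show "pw p i j * act 1 x j = pw p i j * (c ((m i + p) mod r) * x j)"
    proof (cases "0 < pw p i j")
      case True
      then show ?thesis using cyclic_partition_walk[OF m Suc.prems j True] c[OF j] by simp
    next
      case False
      then have "pw p i j = 0" using pw_nonneg[OF Suc.prems j, of p] by linarith
      then show ?thesis by simp
    qed
  qed simp
  also have "\<dots> = c ((m i + p) mod r) * act p x i" by (simp add: act_def sum_distrib_left mult_ac)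
  finally show ?case using Suc by simp
qed

end

text \<open>Any \<open>r\<close> consecutive integers run through each residue once, so the product
  makes \<open>q\<close> full turns.\<close>

lemma prod_mod_shift:
  fixes c :: "nat \<Rightarrow> 'a :: comm_monoid_mult"
  assumes r: "0 < r"
  shows "(\<Prod>t<r * q. c ((s + t) mod r)) = (\<Prod>l<r. c l) ^ q"
proof (induction q)
  case 0
  then show ?case by simp
next
  case (Suc q)
  have period: "(\<Prod>t<r. c ((s + t) mod r)) = (\<Prod>l<r. c l)"
  proof (rule prod.reindex_bij_betw)
    have inj: "inj_on (\<lambda>t. (s + t) mod r) {..<r}"
    proof (rule inj_onI)
      fix a b assume "a \<in> {..<r}" "b \<in> {..<r}" "(s + a) mod r = (s + b) mod r"
      then have "[s + a = s + b] (mod r)" "a < r" "b < r" by (auto simp: cong_def)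
      then have "[a = b] (mod r)" by (simp only: cong_add_lcancel_nat)
      then show "a = b" using \<open>a < r\<close> \<open>b < r\<close> by (simp add: cong_def)
    qed
    have "(\<lambda>t. (s + t) mod r) ` {..<r} \<subseteq> {..<r}" using r by auto
    then have "(\<lambda>t. (s + t) mod r) ` {..<r} = {..<r}"
      using inj by (intro endo_inj_surj) auto
    with inj show "bij_betw (\<lambda>t. (s + t) mod r) {..<r} {..<r}" by (simp add: bij_betw_def)
  qed
  have "(\<Prod>t<r * Suc q. c ((s + t) mod r)) =
      (\<Prod>t<r * q. c ((s + t) mod r)) * (\<Prod>t=r * q..<r * q + r. c ((s + t) mod r))"
    by (simp add: lessThan_atLeast0 prod.atLeastLessThan_concat add.commute)
  also have "(\<Prod>t=r * q..<r * q + r. c ((s + t) mod r)) = (\<Prod>t<r. c ((s + (t + r * q)) mod r))"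
    using prod.shift_bounds_nat_ivl[of "\<lambda>t. c ((s + t) mod r)" 0 "r * q" r]
    by (simp add: lessThan_atLeast0 add.commute)
  also have "\<dots> = (\<Prod>t<r. c ((s + t) mod r))"
    by (simp only: add.assoc[symmetric] mod_mult_self2)
  finally show ?case using Suc period by (simp add: mult.commute)
qed

section \<open>The equality case\<close>

context nonneg_irreducible
begin

lemma powr_inverse_radius_iff:
  assumes "0 < T" "0 \<le> q"
  shows "q powr (1 / real T) \<le> \<rho> \<longleftrightarrow> q \<le> \<rho> ^ T" "\<rho> \<le> q powr (1 / real T) \<longleftrightarrow> \<rho> ^ T \<le> q"
proof -
  have "(q powr (1 / real T)) ^ T = q"
    using assms by (cases "q = 0") (simp_all add: powr_realpow[symmetric] powr_powr)
  then show "q powr (1 / real T) \<le> \<rho> \<longleftrightarrow> q \<le> \<rho> ^ T" "\<rho> \<le> q powr (1 / real T) \<longleftrightarrow> \<rho> ^ T \<le> q"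
    using power_mono_iff[of "q powr (1 / real T)" \<rho> T] power_mono_iff[of \<rho> "q powr (1 / real T)" T]
      assms(1) spectral_radius_pos by simp_all
qed

text \<open>Comparing \<open>\<mu>\<close> with \<open>\<rho> ^ p\<close> either way gives a
  one-sided inequality in all coordinates, to which \<open>semieigenvector_eq\<close>
  applies.\<close>

lemma positive_eigenvector_eigenvalue:
  assumes x: "\<And>i. i < n \<Longrightarrow> 0 < x i" and eig: "\<And>i. i < n \<Longrightarrow> act p x i = \<mu> * x i"
  shows "\<mu> = \<rho> ^ p"
proof -
  have "(\<forall>i<n. act p x i \<le> \<rho> ^ p * x i) \<or> (\<forall>i<n. \<rho> ^ p * x i \<le> act p x i)"
  proof (cases "\<mu> \<le> \<rho> ^ p")
    case True
    then have "act p x i \<le> \<rho> ^ p * x i" if "i < n" for i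
      using mult_right_mono[OF True less_imp_le[OF x[OF that]]] eig[OF that] by simp
    then show ?thesis by blast
  next
    case False
    then have "\<rho> ^ p * x i \<le> act p x i" if "i < n" for i
      using mult_right_mono[of "\<rho> ^ p" \<mu>, OF _ less_imp_le[OF x[OF that]]] eig[OF that] by simp
    then show ?thesis by blast
  qed
  then have "\<mu> * x 0 = \<rho> ^ p * x 0" using semieigenvector_eq[OF _ n_pos] eig[OF n_pos] by metis
  then show ?thesis using x[OF n_pos] by simp
qed

lemma class_eigenvector_of_bound:
  assumes T: "0 < M + N" and r: "r = gcd period (M + N)" and m: "cyclic_partition A r m"
    and x: "\<And>i. i < n \<Longrightarrow> 0 < x i"
    and bound: "(\<forall>(i, j) \<in> support_pairs (A ^\<^sub>m M). act M x i * act N x j / (x i * x j) \<le> \<rho> ^ (M + N)) \<or>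
      (\<forall>(i, j) \<in> support_pairs (A ^\<^sub>m M). \<rho> ^ (M + N) \<le> act M x i * act N x j / (x i * x j))"
  shows "\<exists>c. \<forall>i<n. act 1 x i = c (m i) * x i"
proof -
  let ?T = "M + N"
  have act_x: "0 < act p x i" if "i < n" for p i by (rule act_pos_vector[OF that]) (rule x)
  \<comment> \<open>Multiplication by the positive \<open>act M x i\<close> puts both sides over the
    same weights \<open>pw M i j\<close>, so that the ratio can be bounded summand by
    summand.\<close>
  have expand: "act ?T x i * act M x i = (\<Sum>j<n. pw M i j * (act M x i * act N x j))"
    "(\<rho> ^ ?T * x i) * act M x i = (\<Sum>j<n. pw M i j * (\<rho> ^ ?T * (x i * x j)))" if "i < n" for i
  proof -
    show "act ?T x i * act M x i = (\<Sum>j<n. pw M i j * (act M x i * act N x j))"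
      using act_add[OF that, of M N x] by (simp add: act_def[of M "act N x"] sum_distrib_left mult_ac)
    show "(\<rho> ^ ?T * x i) * act M x i = (\<Sum>j<n. pw M i j * (\<rho> ^ ?T * (x i * x j)))"
      by (simp add: act_def sum_distrib_left mult_ac)
  qed
  \<comment> \<open>The hypothesis speaks only about support pairs; all other summands
    vanish.\<close>
  have zero: "pw M i j = 0" if "i < n" "j < n" "(i, j) \<notin> support_pairs (A ^\<^sub>m M)" for i j
    using that pw_nonneg[of i j M] mem_support_pairs[of i j M] by linarith
  have semi: "(\<forall>i<n. act ?T x i \<le> \<rho> ^ ?T * x i) \<or> (\<forall>i<n. \<rho> ^ ?T * x i \<le> act ?T x i)"
    using bound
  proof
    assume le: "\<forall>(i, j) \<in> support_pairs (A ^\<^sub>m M). act M x i * act N x j / (x i * x j) \<le> \<rho> ^ ?T"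
    have "act ?T x i \<le> \<rho> ^ ?T * x i" if i: "i < n" for i
    proof -
      have "pw M i j * (act M x i * act N x j) \<le> pw M i j * (\<rho> ^ ?T * (x i * x j))" if j: "j < n" for j
      proof (cases "(i, j) \<in> support_pairs (A ^\<^sub>m M)")
        case True
        then have "act M x i * act N x j / (x i * x j) \<le> \<rho> ^ ?T" using le by blast
        then have "act M x i * act N x j \<le> \<rho> ^ ?T * (x i * x j)"
          using x[OF i] x[OF j] by (subst (asm) pos_divide_le_eq) simp_all
        then show ?thesis using pw_nonneg[OF i j] by (rule mult_left_mono)
      qed (simp add: zero i j)
      then have "act ?T x i * act M x i \<le> (\<rho> ^ ?T * x i) * act M x i"
        unfolding expand[OF i] by (intro sum_mono) simp
      then show ?thesis using act_x[OF i, of M] by (rule mult_right_le_imp_le)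
    qed
    then show ?thesis by blast
  next
    assume ge: "\<forall>(i, j) \<in> support_pairs (A ^\<^sub>m M). \<rho> ^ ?T \<le> act M x i * act N x j / (x i * x j)"
    have "\<rho> ^ ?T * x i \<le> act ?T x i" if i: "i < n" for i
    proof -
      have "pw M i j * (\<rho> ^ ?T * (x i * x j)) \<le> pw M i j * (act M x i * act N x j)" if j: "j < n" for j
      proof (cases "(i, j) \<in> support_pairs (A ^\<^sub>m M)")
        case True
        then have "\<rho> ^ ?T \<le> act M x i * act N x j / (x i * x j)" using ge by blast
        then have "\<rho> ^ ?T * (x i * x j) \<le> act M x i * act N x j"
          using x[OF i] x[OF j] by (subst (asm) pos_le_divide_eq) simp_all
        then show ?thesis using pw_nonneg[OF i j] by (rule mult_left_mono)
      qed (simp add: zero i j)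
      then have "(\<rho> ^ ?T * x i) * act M x i \<le> act ?T x i * act M x i"
        unfolding expand[OF i] by (intro sum_mono) simp
      then show ?thesis using act_x[OF i, of M] by (rule mult_right_le_imp_le)
    qed
    then show ?thesis by blast
  qed
  have eig_x: "act ?T x i = \<rho> ^ ?T * x i" if "i < n" for i
    by (rule semieigenvector_eq[OF semi that])
  \<comment> \<open>\<open>A\<close> commutes with \<open>A ^\<^sub>m (M + N)\<close>, so
    \<open>A x\<close> is an eigenvector for the same eigenvalue and can be compared with
    \<open>x\<close>.\<close>
  have eig_y: "act ?T (act 1 x) i = \<rho> ^ ?T * act 1 x i" if "i < n" for i
  proof -
    have "act ?T (act 1 x) i = act 1 (act ?T x) i"
      using act_add[OF that, of ?T 1 x] act_add[OF that, of 1 ?T x] by (simp add: add.commute)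
    also have "\<dots> = act 1 (\<lambda>j. \<rho> ^ ?T * x j) i" by (rule act_cong) (rule eig_x)
    finally show ?thesis by (simp only: act_scaled)
  qed
  show ?thesis by (rule eigenvectors_proportional_on_classes[OF T r m x eig_x eig_y])
qed

text \<open>The factors from \<open>i\<close> cover \<open>M\<close> consecutive classes starting at
  \<open>m i\<close>, and those from \<open>j\<close> the next \<open>N\<close>, as \<open>j\<close>
  lies \<open>M\<close> steps further. Altogether that is a whole number of turns, each worth
  \<open>\<rho> ^ r\<close>, because \<open>act r\<close> multiplies the positive vector
  \<open>x\<close> by the product of all \<open>c l\<close>.\<close>

lemma class_eigenvector_products:
  assumes T: "0 < M + N" and r: "r = gcd period (M + N)" and m: "cyclic_partition A r m"
    and x: "\<And>i. i < n \<Longrightarrow> 0 < x i" and c: "\<And>i. i < n \<Longrightarrow> act 1 x i = c (m i) * x i"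
  shows "\<rho> ^ r = (\<Prod>l<r. c l)"
    and "(i, j) \<in> support_pairs (A ^\<^sub>m M) \<Longrightarrow> act M x i * act N x j / (x i * x j) = \<rho> ^ (M + N)"
proof -
  note ratios = act_class_ratios[OF m c]
  have r0: "0 < r" using r T by simp
  have eig: "act r x i = (\<Prod>l<r. c l) * x i" if "i < n" for i
    using ratios[OF _ that, of r] prod_mod_shift[OF r0, of c "m i" 1] by simp
  have P: "(\<Prod>l<r. c l) = \<rho> ^ r"
    by (rule positive_eigenvector_eigenvalue[where x = x]) (use x eig in auto)
  then show "\<rho> ^ r = (\<Prod>l<r. c l)" by (rule sym)
  assume "(i, j) \<in> support_pairs (A ^\<^sub>m M)"
  then have ij: "i < n" "j < n" "0 < pw M i j" by (simp_all add: mem_support_pairs)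
  have "r dvd M + N" unfolding r by (rule gcd_dvd2)
  then obtain q where q: "M + N = r * q" ..
  have shift: "c ((m j + t) mod r) = c ((m i + (M + t)) mod r)" for t
    using cyclic_partition_walk[OF m ij] by (simp add: mod_add_left_eq add.assoc)
  have "act M x i * act N x j =
      ((\<Prod>t<M. c ((m i + t) mod r)) * (\<Prod>t<N. c ((m i + (M + t)) mod r))) * (x i * x j)"
    using ratios[OF _ ij(1), of M] ratios[OF _ ij(2), of N] by (simp add: shift mult_ac)
  also have "(\<Prod>t<M. c ((m i + t) mod r)) * (\<Prod>t<N. c ((m i + (M + t)) mod r)) =
      (\<Prod>t<M + N. c ((m i + t) mod r))"
    by (induction N) (simp_all add: mult_ac)
  also have "\<dots> = \<rho> ^ (M + N)" by (simp add: q prod_mod_shift[OF r0] P power_mult)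
  finally show "act M x i * act N x j / (x i * x j) = \<rho> ^ (M + N)"
    using x[OF ij(1)] x[OF ij(2)] by simp
qed

text \<open>A minimum equal to \<open>\<rho>\<close> puts every ratio on one side, a maximum on the
  other; either one-sided bound already yields class ratios. Conversely these make all ratios equal
  to \<open>\<rho>\<close>, so both bounds are attained at once.\<close>

lemma equality_iff_class_ratios:
  assumes T: "0 < M + N" and r: "r = gcd period (M + N)" and m: "cyclic_partition A r m"
  shows "lower_bound A M N k = \<rho> \<longleftrightarrow> (\<exists>c. class_ratios A k m c)"
    and "\<rho> = upper_bound A M N k \<longleftrightarrow> (\<exists>c. class_ratios A k m c)"
    and "class_ratios A k m c \<Longrightarrow> \<rho> ^ r = (\<Prod>l<r. c l)"
proof -
  define x where "x = row_sum (A ^\<^sub>m k)"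
  let ?S = "support_pairs (A ^\<^sub>m M)"
  let ?q = "\<lambda>i j. act M x i * act N x j / (x i * x j)"
  let ?f = "\<lambda>(i, j). row_sum_ratio A M N k i j"
  \<comment> \<open>Every row of every power has a positive entry, so no denominator
    vanishes.\<close>
  have x: "0 < x i" if "i < n" for i
    unfolding x_def row_sum_pow by (rule act_pos_vector[OF that]) simp
  have act_x: "0 < act p x i" if "i < n" for p i by (rule act_pos_vector[OF that]) (rule x)
  have ratio: "row_sum_ratio A M N k i j = ?q i j powr (1 / real (M + N))" "0 \<le> ?q i j"
    if "(i, j) \<in> ?S" for i j
  proof -
    have ij: "i < n" "j < n" using that by (simp_all add: mem_support_pairs)
    show "row_sum_ratio A M N k i j = ?q i j powr (1 / real (M + N))"
      unfolding row_sum_ratio_def row_sum_pow_add[OF ij(1)] row_sum_pow_add[OF ij(2)] x_def ..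
    show "0 \<le> ?q i j" using act_x[OF ij(1), of M] act_x[OF ij(2), of N] x ij by (simp add: less_imp_le)
  qed
  have class_iff: "class_ratios A k m c \<longleftrightarrow> (\<forall>i<n. act 1 x i = c (m i) * x i)" for c
  proof -
    have "row_sum (A ^\<^sub>m (k + 1)) i / row_sum (A ^\<^sub>m k) i = c (m i) \<longleftrightarrow> act 1 x i = c (m i) * x i"
      if "i < n" for i
      using x[OF that] unfolding row_sum_pow_add[OF that] x_def[symmetric] by (simp add: divide_eq_eq)
    then show ?thesis using carrier by (simp add: class_ratios_def)
  qed
  have fin: "finite (?f ` ?S)" and ne: "?f ` ?S \<noteq> {}"
    using finite_support_pairs support_pairs_nonempty by simp_all
  have eq: "lower_bound A M N k = \<rho>" "\<rho> = upper_bound A M N k" if "class_ratios A k m c" for c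
  proof -
    have c: "\<And>i. i < n \<Longrightarrow> act 1 x i = c (m i) * x i" using that class_iff by blast
    have "?f p = \<rho>" if "p \<in> ?S" for p
    proof -
      obtain i j where p: "p = (i, j)" by (cases p)
      have "?q i j = \<rho> ^ (M + N)"
        using class_eigenvector_products(2)[OF T r m x c] that p by blast
      then show ?thesis
        using ratio[of i j] powr_inverse_radius_iff[OF T, of "?q i j"] that p by (intro order_antisym) auto
    qed
    then have "?f ` ?S = {\<rho>}" using support_pairs_nonempty[of M] by auto
    then show "lower_bound A M N k = \<rho>" "\<rho> = upper_bound A M N k"
      by (simp_all add: lower_bound_def upper_bound_def)
  qed
  have ex_class: "\<exists>c. class_ratios A k m c"
    if "(\<forall>(i, j) \<in> ?S. ?q i j \<le> \<rho> ^ (M + N)) \<or> (\<forall>(i, j) \<in> ?S. \<rho> ^ (M + N) \<le> ?q i j)"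
    unfolding class_iff by (rule class_eigenvector_of_bound[OF T r m _ that]) (rule x)
  show "lower_bound A M N k = \<rho> \<longleftrightarrow> (\<exists>c. class_ratios A k m c)"
  proof
    assume lower: "lower_bound A M N k = \<rho>"
    have "\<rho> ^ (M + N) \<le> ?q i j" if "(i, j) \<in> ?S" for i j
    proof -
      have "\<rho> \<le> ?f (i, j)"
        unfolding lower[symmetric] lower_bound_def by (rule Min_le[OF fin]) (use that in blast)
      then show ?thesis using ratio[OF that] powr_inverse_radius_iff(2)[OF T, of "?q i j"] by simp
    qed
    then show "\<exists>c. class_ratios A k m c" by (intro ex_class) blast
  qed (use eq in blast)
  show "\<rho> = upper_bound A M N k \<longleftrightarrow> (\<exists>c. class_ratios A k m c)"
  proof
    assume upper: "\<rho> = upper_bound A M N k"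
    have "?q i j \<le> \<rho> ^ (M + N)" if "(i, j) \<in> ?S" for i j
    proof -
      have "?f (i, j) \<le> \<rho>"
        unfolding upper upper_bound_def by (rule Max_ge[OF fin]) (use that in blast)
      then show ?thesis using ratio[OF that] powr_inverse_radius_iff(1)[OF T, of "?q i j"] by simp
    qed
    then show "\<exists>c. class_ratios A k m c" by (intro ex_class) blast
  qed (use eq in blast)
  show "\<rho> ^ r = (\<Prod>l<r. c l)" if ratios: "class_ratios A k m c"
  proof -
    have "\<forall>i<n. act 1 x i = c (m i) * x i" using ratios unfolding class_iff .
    then show ?thesis
      using x by (intro class_eigenvector_products(1)[OF T r m, where x = x]) auto
  qed
qed

end

text \<open>The partition is determined only up to relabeling, so the equivalences are claimed for
  every \<open>m\<close>; existence is asserted as well, so that they are not vacuous.\<close>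

theorem theorem12:
  fixes A :: "real mat" and n M N k h r :: nat
  assumes "2 \<le> n"
    and "A \<in> carrier_mat n n"
    and "nonnegative_mat A"
    and "irreducible_mat A"
    and "\<forall>i < n. row_sum A i \<noteq> 0"
    and "h = imprimitivity_index A"
    and "0 < M"
    and "r = gcd h (M + N)"
  shows "(reducible_mat (A ^\<^sub>m (M + N)) \<longleftrightarrow> 1 < r) \<and>
    (reducible_mat (A ^\<^sub>m (M + N)) \<longrightarrow>
      (\<exists>m. cyclic_partition A r m) \<and>
      (\<forall>m. cyclic_partition A r m \<longrightarrow>
        (lower_bound A M N k = real_spectral_radius A \<longleftrightarrow> (\<exists>c. class_ratios A k m c)) \<and>
        (real_spectral_radius A = upper_bound A M N k \<longleftrightarrow> (\<exists>c. class_ratios A k m c)) \<and>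
        (\<forall>c. class_ratios A k m c \<longrightarrow> real_spectral_radius A ^ r = (\<Prod>l<r. c l))))"
proof -
  interpret nonneg_irreducible A n by unfold_locales (use assms in auto)
  have T: "0 < M + N" using assms(7) by simp
  have r: "r = gcd period (M + N)" using assms(6,8) imprimitivity_index_eq_period by simp
  have "reducible_mat (A ^\<^sub>m (M + N)) \<longleftrightarrow> 1 < r" unfolding r by (rule reducible_pow_iff[OF T])
  moreover have "\<exists>m. cyclic_partition A r m"
    by (rule cyclic_partition_exists) (unfold r, rule gcd_dvd1)
  ultimately show ?thesis using equality_iff_class_ratios[OF T r] unfolding \<rho>_def by blast
qed

end
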